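(* Let $\lambda$ be either $\aleph_0$ or a strong limit cardinal of cofinality $\aleph_0$. Let $\langle G_m,\pi_{m,n}: m\le n<\omega\rangle$ be an inverse system of groups with each $|G_n|<\lambda$, where $\pi_{m,n}:G_n\to G_m$ are homomorphisms with $\pi_{\alpha,\beta}\circ\pi_{\beta,\gamma}=\pi_{\alpha,\gamma}$ for $\alpha\le\beta\le\gamma$ and $\pi_{\alpha,\alpha}$ the identity; let $G_\omega$ with maps $\pi_{n,\omega}:G_\omega\to G_n$ be its inverse limit. Let $\mathbf I$ be a finite index set, and for each $t\in\mathbf I$ let $\langle H^t_m,\pi^t_{m,n}: m\le n<\omega\rangle$ be an inverse system of groups with each $|H^t_n|<\lambda$ (same conventions), with inverse limit $H^t_\omega$ and maps $\pi^t_{n,\omega}$. For each $t\in\mathbf I$ and $n<\omega$ let $\sigma^t_n:H^t_n\to G_n$ be a homomorphism such that $\pi_{m,n}\circ\sigma^t_n=\sigma^t_m\circ\pi^t_{m,n}$ for all $m\le n<\omega$, and let $\sigma^t_\omega:H^t_\omega\to G_\omega$ be the induced homomorphism. Assume that for every cardinal $\mu<\lambda$ there is a sequence $\langle f_i\in G_\omega: i<\mu\rangle$ such that for all $i\ne j<\mu$ and all $t\in\mathbf I$, $f_if_j^{-1}\notin\operatorname{Rang}(\sigma^t_\omega)$. Then there is a sequence $\langle f_i\in G_\omega: i<2^\lambda\rangle$ such that for all $i\ne j<2^\lambda$ and all $t\in\mathbf I$, $f_if_j^{-1}\notin\operatorname{Rang}(\sigma^t_\omega)$.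
   Context: The groups need not be abelian. A strong limit cardinal $\lambda$ is one with $2^\kappa<\lambda$ for all $\kappa<\lambda$. *)

theory Defs
  imports "HOL-Algebra.Product_Groups"
begin

unbundle cardinal_syntax

text \<open>
  A cardinal is a relation \<^term>\<open>r\<close> with \<^term>\<open>Card_order r\<close>; the ordinals below it are represented
  by the elements of \<^term>\<open>Field r\<close>. Every cardinal below \<open>r :: 'k rel\<close> is order-isomorphic to a
  cardinal on a subset of the same type \<open>'k\<close>, so quantifying over relations on \<open>'k\<close> covers all of
  them.
\<close>

definition strong_limit_card :: "'k rel \<Rightarrow> bool" where
  "strong_limit_card r \<longleftrightarrow>
     Card_order r \<and> (\<forall>k :: 'k rel. Card_order k \<and> k <o r \<longrightarrow> ctwo ^c k <o r)"

text \<open>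
  \<^const>\<open>cofinal\<close> asks for strict upper bounds. On an infinite cardinal this agrees with the usual
  non-strict notion, since there is no greatest element.
\<close>

definition has_cofinality :: "'k rel \<Rightarrow> 'c rel \<Rightarrow> bool" where
  "has_cofinality r c \<longleftrightarrow>
     (\<exists>A \<subseteq> Field r. cofinal A r \<and> |A| =o c) \<and>
     (\<forall>A \<subseteq> Field r. cofinal A r \<longrightarrow> c \<le>o |A| )"

definition inverse_system :: "(nat \<Rightarrow> 'a monoid) \<Rightarrow> (nat \<Rightarrow> nat \<Rightarrow> 'a \<Rightarrow> 'a) \<Rightarrow> bool" where
  "inverse_system G \<pi> \<longleftrightarrow>
     (\<forall>n. group (G n)) \<and>
     (\<forall>m n. m \<le> n \<longrightarrow> \<pi> m n \<in> hom (G n) (G m)) \<and>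
     (\<forall>n. \<forall>x\<in>carrier (G n). \<pi> n n x = x) \<and>
     (\<forall>k m n. k \<le> m \<longrightarrow> m \<le> n \<longrightarrow> (\<forall>x\<in>carrier (G n). \<pi> k m (\<pi> m n x) = \<pi> k n x))"

definition inverse_limit :: "(nat \<Rightarrow> 'a monoid) \<Rightarrow> (nat \<Rightarrow> nat \<Rightarrow> 'a \<Rightarrow> 'a) \<Rightarrow> (nat \<Rightarrow> 'a) monoid" where
  "inverse_limit G \<pi> =
     (product_group UNIV G)
       \<lparr>carrier := {x \<in> carrier (product_group UNIV G). \<forall>m n. m \<le> n \<longrightarrow> \<pi> m n (x n) = x m}\<rparr>"

definition limit_proj :: "nat \<Rightarrow> (nat \<Rightarrow> 'a) \<Rightarrow> 'a" where
  "limit_proj n x = x n"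

definition inverse_system_hom ::
  "(nat \<Rightarrow> 'b monoid) \<Rightarrow> (nat \<Rightarrow> nat \<Rightarrow> 'b \<Rightarrow> 'b) \<Rightarrow> (nat \<Rightarrow> 'a monoid) \<Rightarrow> (nat \<Rightarrow> nat \<Rightarrow> 'a \<Rightarrow> 'a)
    \<Rightarrow> (nat \<Rightarrow> 'b \<Rightarrow> 'a) \<Rightarrow> bool" where
  "inverse_system_hom H \<rho> G \<pi> \<sigma> \<longleftrightarrow>
     (\<forall>n. \<sigma> n \<in> hom (H n) (G n)) \<and>
     (\<forall>m n. m \<le> n \<longrightarrow> (\<forall>x\<in>carrier (H n). \<pi> m n (\<sigma> n x) = \<sigma> m (\<rho> m n x)))"

definition limit_map :: "(nat \<Rightarrow> 'b \<Rightarrow> 'a) \<Rightarrow> (nat \<Rightarrow> 'b) \<Rightarrow> nat \<Rightarrow> 'a" where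
  "limit_map \<sigma> x = (\<lambda>n. \<sigma> n (x n))"

lemma carrier_inverse_limit:
  "carrier (inverse_limit G \<pi>) =
     {x. (\<forall>n. x n \<in> carrier (G n)) \<and> (\<forall>m n. m \<le> n \<longrightarrow> \<pi> m n (x n) = x m)}"
  by (auto simp: inverse_limit_def)

lemma mult_inverse_limit: "x \<otimes>\<^bsub>inverse_limit G \<pi>\<^esub> y = (\<lambda>n. x n \<otimes>\<^bsub>G n\<^esub> y n)"
  by (simp add: inverse_limit_def fun_eq_iff)

lemma group_inverse_limit:
  assumes "inverse_system G \<pi>"
  shows "group (inverse_limit G \<pi>)"
proof -
  have G: "\<And>n. group (G n)" and h: "\<And>m n. m \<le> n \<Longrightarrow> group_hom (G n) (G m) (\<pi> m n)"
    using assms by (auto simp: inverse_system_def group_hom_def group_hom_axioms_def)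
  have h_inv: "\<pi> m n (inv\<^bsub>G n\<^esub> x) = inv\<^bsub>G m\<^esub> (\<pi> m n x)"
    and h_mult: "y \<in> carrier (G n) \<Longrightarrow> \<pi> m n (x \<otimes>\<^bsub>G n\<^esub> y) = \<pi> m n x \<otimes>\<^bsub>G m\<^esub> \<pi> m n y"
    if "m \<le> n" "x \<in> carrier (G n)" for m n x y
    using group_hom.hom_inv[OF h] group_hom.hom_mult[OF h] that by blast+
  let ?P = "product_group UNIV G"
  have P: "group ?P"
    using G by simp
  have "subgroup (carrier (inverse_limit G \<pi>)) ?P"
  proof (rule group.subgroupI[OF P])
    show "carrier (inverse_limit G \<pi>) \<subseteq> carrier ?P"
      by (auto simp: inverse_limit_def)
    have "(\<lambda>n. \<one>\<^bsub>G n\<^esub>) \<in> carrier (inverse_limit G \<pi>)"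
      using G h by (auto simp: carrier_inverse_limit group.is_monoid group_hom.hom_one)
    then show "carrier (inverse_limit G \<pi>) \<noteq> {}" by blast
  next
    fix x assume x: "x \<in> carrier (inverse_limit G \<pi>)"
    then have "inv\<^bsub>?P\<^esub> x = (\<lambda>n\<in>UNIV. inv\<^bsub>G n\<^esub> x n)"
      using G by (intro inv_product_group) (auto simp: carrier_inverse_limit)
    then show "inv\<^bsub>?P\<^esub> x \<in> carrier (inverse_limit G \<pi>)"
      using x G by (auto simp: carrier_inverse_limit h_inv)
  next
    fix x y assume "x \<in> carrier (inverse_limit G \<pi>)" "y \<in> carrier (inverse_limit G \<pi>)"
    then show "x \<otimes>\<^bsub>?P\<^esub> y \<in> carrier (inverse_limit G \<pi>)"
      using G by (auto simp: carrier_inverse_limit h_mult group.is_monoid monoid.m_closed)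
  qed
  then have "group (?P\<lparr>carrier := carrier (inverse_limit G \<pi>)\<rparr>)"
    by (rule subgroup.subgroup_is_group[OF _ P])
  then show ?thesis
    by (simp add: inverse_limit_def)
qed

lemma limit_proj_hom: "limit_proj n \<in> hom (inverse_limit G \<pi>) (G n)"
  by (auto simp: hom_def limit_proj_def carrier_inverse_limit mult_inverse_limit)

lemma limit_proj_compatible:
  "\<lbrakk>x \<in> carrier (inverse_limit G \<pi>); m \<le> n\<rbrakk> \<Longrightarrow> \<pi> m n (limit_proj n x) = limit_proj m x"
  by (simp add: carrier_inverse_limit limit_proj_def)

lemma limit_map_hom:
  assumes "inverse_system_hom H \<rho> G \<pi> \<sigma>"
  shows "limit_map \<sigma> \<in> hom (inverse_limit H \<rho>) (inverse_limit G \<pi>)"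
  using assms
  by (auto simp: inverse_system_hom_def hom_def limit_map_def carrier_inverse_limit
      mult_inverse_limit Pi_iff)

lemma limit_map_unique:
  assumes "\<And>n. limit_proj n (f x) = \<sigma> n (limit_proj n x)"
  shows "f x = limit_map \<sigma> x"
  using assms by (auto simp: limit_map_def limit_proj_def)

end

theory Submission
  imports Defs
begin

text \<open>
  Filter \<open>G\<^sub>\<omega>\<close> by the kernels \<open>U\<^sub>n\<close> of the projections to \<open>G\<^sub>n\<close>; they have index below \<open>\<lambda>\<close> and
  \<open>G\<^sub>\<omega>\<close> is complete. For one \<open>t\<close> let \<open>K\<close> be the range of \<open>\<sigma>\<^sub>\<omega>\<close>, of index at least \<open>\<lambda>\<close>, and \<open>K\<^sub>n\<close>
  the image of the kernel of \<open>H\<^sub>\<omega> \<rightarrow> H\<^sub>n\<close>. Consider complete filtrations \<open>V\<close> by subgroups of index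
  below \<open>\<lambda>\<close>, normalised by \<open>K\<close>, with \<open>K\<^sub>n \<subseteq> V\<^sub>n \<subseteq> U\<^sub>n\<close>. One that is fixed by the operation
  \<open>V\<^sub>n \<mapsto> \<Inter>\<^sub>m K\<^sub>n V\<^sub>m\<close> would satisfy \<open>V\<^sub>0 \<subseteq> K\<close> by the open mapping argument, which is impossible.
  So by Zorn's lemma the refinement breaks down, either at one such closure or along a chain, because
  some index reaches \<open>\<lambda>\<close>. Either way there are a complete filtration \<open>W\<close> and subgroups \<open>L\<^sub>m \<supseteq> W\<^sub>m\<close>,
  all containing one \<open>K\<^sub>n\<close>, of indices below \<open>\<lambda>\<close> but unbounded in \<open>\<lambda>\<close>.

  By B. H. Neumann's covering lemma the finitely many \<open>t\<close> can be treated at once, and a tree of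
  height \<open>\<omega>\<close> of convergent products gives \<open>2\<^sup>\<lambda>\<close> elements that are pairwise incongruent modulo
  every \<open>K\<^sub>n\<close>. As \<open>K\<^sub>n\<close> has index below \<open>\<lambda>\<close> in \<open>K\<close>, congruence modulo some \<open>K\<close> is a graph of
  degree below \<open>\<lambda>\<close> on these elements, so a maximal independent set still has \<open>2\<^sup>\<lambda>\<close> members.
\<close>

section \<open>Strong limit cardinals of countable cofinality\<close>

text \<open>Treats both cases of \<open>lam\<close> at once. Subsets of \<open>'k\<close> suffice in
  the power condition, since every set smaller than \<open>lam\<close> has a copy there.\<close>

locale strong_limit_omega =
  fixes lam :: "'k rel"
  assumes card_lam: "Card_order lam"
    and infinite_lam: "infinite (Field lam)"
    and Pow_less_lam: "\<And>M :: 'k set. |M| <o lam \<Longrightarrow> |Pow M| <o lam"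
    and countable_cofinal: "\<exists>a :: nat \<Rightarrow> 'k. range a \<subseteq> Field lam \<and> cofinal (range a) lam"
begin

text \<open>Coset systems live in other types; this moves their cardinals to \<open>'k\<close>, over
  whose subsets the bounds below \<open>lam\<close> are quantified.\<close>

lemma small_copy:
  assumes "|X| <o lam"
  obtains M :: "'k set" where "|X| =o |M|" "|M| <o lam"
proof -
  obtain M :: "'k set" where "|X| =o |M|"
    using internalize_card_of_ordLess[of X lam] assms by blast
  then show thesis
    using assms that ordIso_ordLess_trans ordIso_symmetric by blast
qed

lemma small_finite: "finite X \<Longrightarrow> |X| <o lam"
  using infinite_lam card_lam
  by (intro finite_ordLess_infinite) (auto simp: Field_card_of card_of_well_order_on card_order_on_def)

lemma small_mono: "|X| \<le>o |Y| \<Longrightarrow> |Y| <o lam \<Longrightarrow> |X| <o lam"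
  by (rule ordLeq_ordLess_trans)

lemma small_Times: "|X| <o lam \<Longrightarrow> |Y| <o lam \<Longrightarrow> |X \<times> Y| <o lam"
proof -
  assume X: "|X| <o lam" and Y: "|Y| <o lam"
  show ?thesis
  proof (cases "finite X \<and> finite Y")
    case True
    then show ?thesis by (intro small_finite) auto
  next
    case False
    have 1: "|X \<times> Y| \<le>o |(X <+> Y) \<times> (X <+> Y)|"
      using card_of_Times_mono1[OF card_of_Plus1] card_of_Times_mono2[OF card_of_Plus2]
      by (metis ordLeq_transitive)
    have "|(X <+> Y) \<times> (X <+> Y)| =o |X <+> Y|"
      using False by (intro card_of_Times_same_infinite) auto
    moreover have "|X <+> Y| <o lam"
      using card_of_Plus_ordLess_infinite_Field[OF infinite_lam card_lam X Y] .
    ultimately show ?thesis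
      using 1 ordLeq_ordLess_trans ordIso_ordLess_trans by blast
  qed
qed

lemma small_Un: "|X| <o lam \<Longrightarrow> |Y| <o lam \<Longrightarrow> |X \<union> Y| <o lam"
  using card_of_Un_ordLess_infinite_Field[OF infinite_lam card_lam] .

lemma small_Pow:
  assumes "|X| <o lam" shows "|Pow X| <o lam"
proof -
  obtain M :: "'k set" where M: "|X| =o |M|" "|M| <o lam"
    using small_copy[OF assms] .
  obtain f where "bij_betw f X M" using M(1) card_of_ordIso by blast
  then have "bij_betw (image f) (Pow X) (Pow M)" by (rule bij_betw_Pow)
  then have "|Pow X| =o |Pow M|" using card_of_ordIso by blast
  then show ?thesis using Pow_less_lam[OF M(2)] ordIso_ordLess_trans by blast
qed

text \<open>Proper initial segments of a cardinal are small, and those below the terms of a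
  countable cofinal sequence exhaust \<open>lam\<close>. The sets \<open>A n\<close> later serve
  both as levels of the tree and as bounds cofinal among the cardinals below
  \<open>lam\<close>.\<close>

lemma exhaustion:
  obtains A :: "nat \<Rightarrow> 'k set" where "\<And>n. |A n| <o lam" "(\<Union>n. A n) = Field lam"
    "\<And>m n. m \<le> n \<Longrightarrow> A m \<subseteq> A n" "\<And>M :: 'k set. |M| <o lam \<Longrightarrow> \<exists>n. |M| \<le>o |A n|"
proof -
  obtain a :: "nat \<Rightarrow> 'k" where a: "range a \<subseteq> Field lam" "cofinal (range a) lam"
    using countable_cofinal by blast
  have wo: "Well_order lam" using card_lam by (simp add: card_order_on_def)
  \<comment> \<open>Unions over \<open>i \<le> n\<close> make the sets increase even if
    \<open>a\<close> is not monotone.\<close>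
  define A where "A n = (\<Union>i\<le>n. underS lam (a i))" for n
  have small: "|A n| <o lam" for n
  proof (induction n)
    case 0
    then show ?case using card_of_underS[OF card_lam] a(1) by (auto simp: A_def)
  next
    case (Suc n)
    have "A (Suc n) = A n \<union> underS lam (a (Suc n))"
      by (auto simp: A_def le_Suc_eq)
    then show ?case
      using small_Un[OF Suc card_of_underS[OF card_lam]] a(1) by (simp add: image_subset_iff)
  qed
  have sub: "underS lam x \<subseteq> underS lam (a n) \<and> x \<in> underS lam (a n)" 
    if "x \<noteq> a n" "(x, a n) \<in> lam" for x n
    using that wo
    by (auto simp: underS_def well_order_on_def linear_order_on_def partial_order_on_def
        preorder_on_def antisym_def dest: transD)
  have un: "(\<Union>n. A n) = Field lam"
  proof
    show "(\<Union>n. A n) \<subseteq> Field lam"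
      by (auto simp: A_def underS_def Field_def)
    show "Field lam \<subseteq> (\<Union>n. A n)"
    proof
      fix x assume "x \<in> Field lam"
      then obtain n where "x \<noteq> a n" "(x, a n) \<in> lam"
        using a(2) by (auto simp: cofinal_def)
      then have "x \<in> A n" using sub by (auto simp: A_def)
      then show "x \<in> (\<Union>n. A n)" by blast
    qed
  qed
  have cof: "\<exists>n. |M| \<le>o |A n|" if M: "|M| <o lam" for M :: "'k set"
  proof -
    obtain x where x: "x \<in> Field lam" "|M| =o Restr lam (underS lam x)"
      using ordLess_iff_ordIso_Restr[OF wo card_of_Well_order, of M] M by blast
    have "|Field (Restr lam (underS lam x))| =o |M|"
      using card_of_cong[OF ordIso_symmetric[OF x(2)]]
      by (simp add: Field_card_of)
    moreover have "Field (Restr lam (underS lam x)) \<subseteq> underS lam x"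
      by (auto simp: Field_def)
    ultimately have M_le: "|M| \<le>o |underS lam x|"
      using card_of_mono1 ordIso_ordLeq_trans ordIso_symmetric by blast
    obtain n where "x \<noteq> a n" "(x, a n) \<in> lam"
      using a(2) x(1) by (auto simp: cofinal_def)
    then have "underS lam x \<subseteq> A n" using sub by (fastforce simp: A_def)
    then show ?thesis using M_le card_of_mono1 ordLeq_transitive by blast
  qed
  have mono: "A m \<subseteq> A n" if "m \<le> n" for m n
    using that by (fastforce simp: A_def)
  show thesis by (rule that[OF small un mono cof])
qed

end

text \<open>Below \<open>natLeq\<close> all sets are finite, hence so are their power sets, and an
  enumeration of the whole field is cofinal. In the other case the power condition is
  \<open>ctwo ^c |M| <o lam\<close>, and the sequence enumerates a witness of the
  cofinality.\<close>

lemma strong_limit_omegaI: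
  fixes lam :: "'k rel"
  assumes "Card_order lam"
    and "lam =o natLeq \<or> (strong_limit_card lam \<and> has_cofinality lam natLeq)"
  shows "strong_limit_omega lam"
  using assms(2)
proof
  assume nat: "lam =o natLeq"
  have lam_nat: "|Field lam| =o |UNIV :: nat set|"
    by (meson assms(1) card_of_Field_ordIso card_of_nat nat ordIso_symmetric ordIso_transitive)
  then have inf: "infinite (Field lam)"
    using card_of_ordIso_finite infinite_UNIV_nat by blast
  obtain a :: "nat \<Rightarrow> 'k" where a: "bij_betw a UNIV (Field lam)"
    using lam_nat card_of_ordIso ordIso_symmetric by metis
  show ?thesis
  proof
    show "|Pow M| <o lam" if "|M| <o lam" for M :: "'k set"
    proof -
      have "|M| <o natLeq" using that nat ordLess_ordIso_trans by blast
      then have "finite (Pow M)" using finite_iff_ordLess_natLeq by blast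
      then have "|Pow M| <o natLeq" using finite_iff_ordLess_natLeq by blast
      then show ?thesis using nat ordIso_symmetric ordLess_ordIso_trans by blast
    qed
    have "cofinal (Field lam) lam"
      using infinite_Card_order_limit[OF assms(1) inf] by (auto simp: cofinal_def)
    then show "\<exists>a :: nat \<Rightarrow> 'k. range a \<subseteq> Field lam \<and> cofinal (range a) lam"
      using a by (metis bij_betw_imp_surj_on subset_refl)
  qed (fact assms(1) inf)+
next
  assume sl: "strong_limit_card lam \<and> has_cofinality lam natLeq"
  then obtain A where A: "A \<subseteq> Field lam" "cofinal A lam" "|A| =o natLeq"
    by (auto simp: has_cofinality_def)
  have "|UNIV :: nat set| =o |A|"
    using A(3) card_of_nat ordIso_symmetric ordIso_transitive by blast
  then obtain a :: "nat \<Rightarrow> 'k" where a: "bij_betw a UNIV A"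
    using card_of_ordIso by metis
  show ?thesis
  proof
    show "infinite (Field lam)"
      using A(1) a by (metis bij_betw_finite finite_subset infinite_UNIV_nat)
    show "|Pow M| <o lam" if "|M| <o lam" for M :: "'k set"
    proof -
      have "ctwo ^c |M| <o lam"
        using sl that card_of_Card_order by (auto simp: strong_limit_card_def)
      moreover have "|Pow M| =o ctwo ^c |M|"
        unfolding ctwo_def cexp_def Field_card_of by (rule card_of_Pow_Func)
      ultimately show ?thesis using ordIso_ordLess_trans by blast
    qed
    show "\<exists>a :: nat \<Rightarrow> 'k. range a \<subseteq> Field lam \<and> cofinal (range a) lam"
      using a A by (metis bij_betw_imp_surj_on)
  qed (fact assms(1))
qed

section \<open>Subgroups of small index\<close>

context group
begin

lemma mult_inv_cancel_mid:
  "\<lbrakk>x \<in> carrier G; y \<in> carrier G; z \<in> carrier G\<rbrakk> \<Longrightarrow> (x \<otimes> inv y) \<otimes> (y \<otimes> inv z) = x \<otimes> inv z"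
  by (metis inv_closed m_assoc m_closed l_inv l_one)

lemma inv_mult_inv: "\<lbrakk>x \<in> carrier G; y \<in> carrier G\<rbrakk> \<Longrightarrow> inv (x \<otimes> inv y) = y \<otimes> inv x"
  by (simp add: inv_mult_group)

lemma rcong_sym:
  assumes "subgroup L G" "x \<in> carrier G" "y \<in> carrier G" "x \<otimes> inv y \<in> L"
  shows "y \<otimes> inv x \<in> L"
  using assms subgroup.m_inv_closed inv_mult_inv by metis

lemma rcong_trans:
  assumes "subgroup L G" "x \<in> carrier G" "y \<in> carrier G" "z \<in> carrier G"
    and "x \<otimes> inv y \<in> L" "y \<otimes> inv z \<in> L"
  shows "x \<otimes> inv z \<in> L"
  using assms subgroup.m_closed[OF assms(1) assms(5,6)] mult_inv_cancel_mid by simp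

text \<open>Moving \<open>a\<close> past \<open>b\<close> costs a conjugation, so \<open>A\<close>
  normalising \<open>B\<close> is enough. This is applied with \<open>K n\<close> and
  \<open>V m\<close>, where \<open>V m\<close> is normalised by the image but perhaps not by
  \<open>G\<close>.\<close>

lemma subgroup_set_mult:
  assumes A: "subgroup A G" and B: "subgroup B G"
    and conj: "\<And>a b. a \<in> A \<Longrightarrow> b \<in> B \<Longrightarrow> a \<otimes> b \<otimes> inv a \<in> B"
  shows "subgroup (A <#> B) G"
proof (rule subgroupI)
  have Ac: "a \<in> carrier G" if "a \<in> A" for a using subgroup.mem_carrier[OF A that] .
  have Bc: "b \<in> carrier G" if "b \<in> B" for b using subgroup.mem_carrier[OF B that] .
  show "A <#> B \<subseteq> carrier G"
    using Ac Bc by (auto simp: set_mult_def)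
  show "A <#> B \<noteq> {}"
    using subgroup.one_closed[OF A] subgroup.one_closed[OF B] by (auto simp: set_mult_def)
  show "inv x \<in> A <#> B" if x: "x \<in> A <#> B" for x
  proof -
    obtain a b where ab: "a \<in> A" "b \<in> B" "x = a \<otimes> b"
      using x unfolding set_mult_def by blast
    have "inv x = inv a \<otimes> (a \<otimes> inv b \<otimes> inv a)"
      using ab Ac Bc by (simp add: inv_mult_group m_assoc[symmetric])
    moreover have "a \<otimes> inv b \<otimes> inv a \<in> B" "inv a \<in> A"
      using conj subgroup.m_inv_closed[OF B] subgroup.m_inv_closed[OF A] ab by auto
    ultimately show ?thesis by (auto simp: set_mult_def)
  qed
  show "x \<otimes> y \<in> A <#> B" if xy: "x \<in> A <#> B" "y \<in> A <#> B" for x y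
  proof -
    obtain a b c d where ab: "a \<in> A" "b \<in> B" "x = a \<otimes> b" "c \<in> A" "d \<in> B" "y = c \<otimes> d"
      using xy unfolding set_mult_def by blast
    have "inv c \<otimes> b \<otimes> c \<in> B"
      using conj[of "inv c" b] subgroup.m_inv_closed[OF A] ab Ac by auto
    then have "(inv c \<otimes> b \<otimes> c) \<otimes> d \<in> B" "a \<otimes> c \<in> A"
      using subgroup.m_closed[OF B] subgroup.m_closed[OF A] ab by auto
    moreover have "x \<otimes> y = (a \<otimes> c) \<otimes> ((inv c \<otimes> b \<otimes> c) \<otimes> d)"
    proof -
      have "c \<otimes> (inv c \<otimes> (b \<otimes> (c \<otimes> d))) = b \<otimes> (c \<otimes> d)"
        using ab Ac Bc by (simp add: m_assoc[symmetric])
      then show ?thesis using ab Ac Bc by (simp add: m_assoc)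
    qed
    ultimately show ?thesis by (auto simp: set_mult_def)
  qed
qed

lemma set_mult_mono: "A \<subseteq> A' \<Longrightarrow> B \<subseteq> B' \<Longrightarrow> A <#> B \<subseteq> A' <#> B'"
  by (auto simp: set_mult_def)

lemma subset_set_mult_left:
  assumes "subgroup A G" "subgroup B G" shows "A \<subseteq> A <#> B"
proof
  fix a assume "a \<in> A"
  then have "a = a \<otimes> \<one>" using subgroup.mem_carrier[OF assms(1)] by simp
  then show "a \<in> A <#> B"
    using \<open>a \<in> A\<close> subgroup.one_closed[OF assms(2)] unfolding set_mult_def by blast
qed

lemma subset_set_mult_right:
  assumes "subgroup A G" "subgroup B G" shows "B \<subseteq> A <#> B"
proof
  fix b assume "b \<in> B"
  then have "b = \<one> \<otimes> b" using subgroup.mem_carrier[OF assms(2)] by simp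
  then show "b \<in> A <#> B"
    using \<open>b \<in> B\<close> subgroup.one_closed[OF assms(1)] unfolding set_mult_def by blast
qed

text \<open>\<open>S\<close> represents right cosets \<open>L s\<close> that cover the group, and of
  \<open>J\<close> only the cardinality counts. For a subgroup \<open>L\<close> this says that its
  index is at most \<open>|J|\<close>.\<close>

definition index_le :: "'a set \<Rightarrow> 'x set \<Rightarrow> bool" where
  "index_le L J \<longleftrightarrow>
     (\<exists>S \<subseteq> carrier G. |S| \<le>o |J| \<and> (\<forall>x \<in> carrier G. \<exists>s \<in> S. x \<otimes> inv s \<in> L))"

definition cauchy :: "(nat \<Rightarrow> 'a set) \<Rightarrow> (nat \<Rightarrow> 'a) \<Rightarrow> bool" where
  "cauchy V y \<longleftrightarrow> (\<forall>n. \<exists>N. \<forall>i\<ge>N. \<forall>j\<ge>N. y i \<otimes> inv (y j) \<in> V n)"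

definition tends :: "(nat \<Rightarrow> 'a set) \<Rightarrow> (nat \<Rightarrow> 'a) \<Rightarrow> 'a \<Rightarrow> bool" where
  "tends V y g \<longleftrightarrow> (\<forall>n. \<exists>N. \<forall>j\<ge>N. g \<otimes> inv (y j) \<in> V n)"

lemma index_le_mono:
  assumes "index_le L J" "L \<subseteq> L'" "|J| \<le>o |J'|"
  shows "index_le L' J'"
proof -
  obtain S where "S \<subseteq> carrier G" "|S| \<le>o |J|" "\<forall>x \<in> carrier G. \<exists>s \<in> S. x \<otimes> inv s \<in> L"
    using assms(1) unfolding index_le_def by blast
  moreover from this have "|S| \<le>o |J'|" using assms(3) ordLeq_transitive by blast
  ultimately show ?thesis using assms(2) unfolding index_le_def by (intro exI[of _ S]) blast
qed

end

locale lam_group = group G + strong_limit_omega lam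
  for G :: "('a, 'm) monoid_scheme" (structure) and lam :: "'k rel"
begin

definition small_index :: "'a set \<Rightarrow> bool" where
  "small_index L \<longleftrightarrow>
     (\<exists>S \<subseteq> carrier G. |S| <o lam \<and> (\<forall>x \<in> carrier G. \<exists>s \<in> S. x \<otimes> inv s \<in> L))"

lemma small_indexE:
  assumes "small_index L"
  obtains S where "S \<subseteq> carrier G" "|S| <o lam" "\<forall>x \<in> carrier G. \<exists>s \<in> S. x \<otimes> inv s \<in> L"
  using assms that unfolding small_index_def by (elim exE conjE) (simp only:)

lemma small_index_iff: "small_index L \<longleftrightarrow> (\<exists>M :: 'k set. |M| <o lam \<and> index_le L M)"
proof
  assume "small_index L"
  then obtain S where S: "S \<subseteq> carrier G" "|S| <o lam" "\<forall>x \<in> carrier G. \<exists>s \<in> S. x \<otimes> inv s \<in> L"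
    by (auto simp: small_index_def)
  obtain M :: "'k set" where "|S| =o |M|" "|M| <o lam" using small_copy[OF S(2)] .
  then show "\<exists>M :: 'k set. |M| <o lam \<and> index_le L M"
    using S ordIso_imp_ordLeq unfolding index_le_def by blast
next
  assume "\<exists>M :: 'k set. |M| <o lam \<and> index_le L M"
  then show "small_index L"
    using small_mono unfolding small_index_def index_le_def by blast
qed

lemma small_index_mono:
  assumes "small_index L" "L \<subseteq> L'"
  shows "small_index L'"
proof -
  obtain M :: "'k set" where M: "|M| <o lam" "index_le L M"
    using assms(1) small_index_iff by auto
  show ?thesis
    using M(1) index_le_mono[OF M(2) assms(2) ordLeq_refl[OF card_of_Card_order]] small_index_iff
    by auto
qed

text \<open>Each fibre of \<open>f\<close> lies in one coset of \<open>L\<close>, so one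
  representative from each fibre is enough.\<close>

lemma small_indexI:
  assumes "|f ` carrier G| <o lam"
    and "\<And>x y. x \<in> carrier G \<Longrightarrow> y \<in> carrier G \<Longrightarrow> f x = f y \<Longrightarrow> x \<otimes> inv y \<in> L"
  shows "small_index L"
proof -
  define S where "S = inv_into (carrier G) f ` f ` carrier G"
  have "|S| <o lam" unfolding S_def using card_of_image assms(1) small_mono by blast
  moreover have "S \<subseteq> carrier G" unfolding S_def by (auto intro: inv_into_into)
  moreover have "\<exists>s \<in> S. x \<otimes> inv s \<in> L" if x: "x \<in> carrier G" for x
  proof
    have fx: "f x \<in> f ` carrier G" using x by blast
    then show "inv_into (carrier G) f (f x) \<in> S" by (simp add: S_def)
    show "x \<otimes> inv (inv_into (carrier G) f (f x)) \<in> L"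
      by (rule assms(2)[OF x inv_into_into[OF fx]]) (simp add: f_inv_into_f[OF fx])
  qed
  ultimately show ?thesis unfolding small_index_def by blast
qed

lemma small_index_Int:
  assumes A: "subgroup A G" "small_index A" and B: "subgroup B G" "small_index B"
  shows "small_index (A \<inter> B)"
proof -
  obtain S where S: "S \<subseteq> carrier G" "|S| <o lam" "\<And>x. x \<in> carrier G \<Longrightarrow> \<exists>s \<in> S. x \<otimes> inv s \<in> A"
    using A(2) by (auto simp: small_index_def)
  obtain T where T: "T \<subseteq> carrier G" "|T| <o lam" "\<And>x. x \<in> carrier G \<Longrightarrow> \<exists>s \<in> T. x \<otimes> inv s \<in> B"
    using B(2) by (auto simp: small_index_def)
  obtain s where s: "\<And>x. x \<in> carrier G \<Longrightarrow> s x \<in> S \<and> x \<otimes> inv (s x) \<in> A"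
    using S(3) by metis
  obtain t where t: "\<And>x. x \<in> carrier G \<Longrightarrow> t x \<in> T \<and> x \<otimes> inv (t x) \<in> B"
    using T(3) by metis
  show ?thesis
  proof (rule small_indexI[where f = "\<lambda>x. (s x, t x)"])
    have "(\<lambda>x. (s x, t x)) ` carrier G \<subseteq> S \<times> T" using s t by auto
    then show "|(\<lambda>x. (s x, t x)) ` carrier G| <o lam"
      using small_mono[OF card_of_mono1 small_Times[OF S(2) T(2)]] by blast
    fix x y assume xy: "x \<in> carrier G" "y \<in> carrier G" "(s x, t x) = (s y, t y)"
    have c: "s y \<in> carrier G" "t y \<in> carrier G" using s[OF xy(2)] t[OF xy(2)] S(1) T(1) by blast+
    have "s y \<otimes> inv y \<in> A" "t y \<otimes> inv y \<in> B"
      using rcong_sym[OF A(1) xy(2) c(1)] rcong_sym[OF B(1) xy(2) c(2)] s[OF xy(2)] t[OF xy(2)] by blast+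
    then show "x \<otimes> inv y \<in> A \<inter> B"
      using rcong_trans[OF A(1) xy(1) c(1) xy(2)] rcong_trans[OF B(1) xy(1) c(2) xy(2)]
        s[OF xy(1)] t[OF xy(1)] xy(3) by simp
  qed
qed

text \<open>Above a member \<open>W\<close> of such a chain there are at most \<open>2\<^sup>|\<^sup>M\<^sup>|\<close> subgroups, so the chain itself has
  fewer than \<open>lam\<close> members, whatever its order type.\<close>

lemma small_index_Inter_chain:
  fixes M :: "'k set"
  assumes ne: "D \<noteq> {}" and sub: "\<And>V. V \<in> D \<Longrightarrow> subgroup V G"
    and chain: "\<And>V W. V \<in> D \<Longrightarrow> W \<in> D \<Longrightarrow> V \<subseteq> W \<or> W \<subseteq> V"
    and M: "|M| <o lam" and idx: "\<And>V. V \<in> D \<Longrightarrow> index_le V M"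
  shows "small_index (\<Inter>D)"
proof -
  obtain S where S: "\<And>V. V \<in> D \<Longrightarrow> S V \<subseteq> carrier G \<and> |S V| \<le>o |M| \<and>
      (\<forall>x \<in> carrier G. \<exists>s \<in> S V. x \<otimes> inv s \<in> V)"
    using idx unfolding index_le_def by metis
  have above: "|{V \<in> D. W \<subseteq> V}| \<le>o |Pow M|" if W: "W \<in> D" for W
  proof -
    \<comment> \<open>A subgroup above \<open>W\<close> is a union of cosets of \<open>W\<close>,
      hence determined by the representatives in \<open>S W\<close> that it contains.\<close>
    have rep: "x \<in> V \<longleftrightarrow> x \<in> carrier G \<and> (\<exists>s \<in> S W \<inter> V. x \<otimes> inv s \<in> W)"
      if V: "V \<in> D" "W \<subseteq> V" for V x
    proof
      assume x: "x \<in> V"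
      then have xc: "x \<in> carrier G" using subgroup.mem_carrier[OF sub[OF V(1)]] by blast
      then obtain s where s: "s \<in> S W" "x \<otimes> inv s \<in> W" using S[OF W] by blast
      have sc: "s \<in> carrier G" using s S[OF W] by blast
      have "inv (x \<otimes> inv s) \<otimes> x \<in> V"
        by (rule subgroup.m_closed[OF sub[OF V(1)]
              subgroup.m_inv_closed[OF sub[OF V(1)] subsetD[OF V(2) s(2)]] x])
      moreover have "inv (x \<otimes> inv s) \<otimes> x = s"
        using xc sc by (simp add: inv_mult_inv m_assoc)
      ultimately show "x \<in> carrier G \<and> (\<exists>s \<in> S W \<inter> V. x \<otimes> inv s \<in> W)" using s xc by auto
    next
      assume "x \<in> carrier G \<and> (\<exists>s \<in> S W \<inter> V. x \<otimes> inv s \<in> W)"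
      then obtain s where s: "x \<in> carrier G" "s \<in> S W" "s \<in> V" "x \<otimes> inv s \<in> W" by blast
      then have "s \<in> carrier G" using S[OF W] by blast
      moreover have "(x \<otimes> inv s) \<otimes> s \<in> V"
        by (rule subgroup.m_closed[OF sub[OF V(1)] subsetD[OF V(2) s(4)] s(3)])
      ultimately show "x \<in> V" using s(1) by (simp add: m_assoc)
    qed
    have "inj_on (\<lambda>V. S W \<inter> V) {V \<in> D. W \<subseteq> V}"
    proof (rule inj_onI)
      fix V V' assume V: "V \<in> {V \<in> D. W \<subseteq> V}" "V' \<in> {V \<in> D. W \<subseteq> V}" "S W \<inter> V = S W \<inter> V'"
      show "V = V'" using rep[of V] rep[of V'] V by blast
    qed
    moreover have "(\<lambda>V. S W \<inter> V) ` {V \<in> D. W \<subseteq> V} \<subseteq> Pow (S W)" by blast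
    ultimately have 1: "|{V \<in> D. W \<subseteq> V}| \<le>o |Pow (S W)|"
      using card_of_ordLeq by blast
    obtain f where f: "inj_on f (S W)" "f ` S W \<subseteq> M" using S[OF W] card_of_ordLeq by metis
    have "inj_on (image f) (Pow (S W))" using inj_on_image_Pow[OF f(1)] .
    then have "|Pow (S W)| \<le>o |Pow M|" using f(2) card_of_ordLeq by (metis image_Pow_mono)
    then show ?thesis using 1 ordLeq_transitive by blast
  qed
  have PM: "|Pow M| <o lam" and PPM: "|Pow (Pow M)| <o lam"
    using small_Pow[OF M] small_Pow[OF small_Pow[OF M]] by blast+
  have D: "|D| <o lam"
  proof (cases "|D| \<le>o |Pow (Pow M)|")
    case True
    then show ?thesis using PPM small_mono by blast
  next
    case False
    then have "|Pow (Pow M)| \<le>o |D|"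
      using ordLeq_total[OF card_of_Well_order card_of_Well_order] by blast
    \<comment> \<open>\<open>T\<close> is too large to lie wholly above one \<open>V\<close>, so in
      the chain each \<open>V\<close> contains a member of \<open>T\<close>. Thus \<open>D\<close>
      is the union, over the small set \<open>T\<close>, of sets of size at most
      \<open>|Pow M|\<close>.\<close>
    then obtain T where T: "T \<subseteq> D" "|Pow (Pow M)| =o |T|"
      using internalize_card_of_ordLeq2[of "Pow (Pow M)" D] by blast
    have "D \<subseteq> (\<Union>W\<in>T. {V \<in> D. W \<subseteq> V})"
    proof
      fix V assume V: "V \<in> D"
      have "\<exists>W\<in>T. W \<subseteq> V"
      proof (rule ccontr)
        assume "\<not> ?thesis"
        then have "T \<subseteq> {W \<in> D. V \<subseteq> W}" using chain V T(1) by blast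
        then have "|T| \<le>o |Pow M|" using above[OF V] card_of_mono1 ordLeq_transitive by blast
        then have "|Pow (Pow M)| \<le>o |Pow M|" using T(2) ordIso_ordLeq_trans by blast
        then show False using card_of_Pow not_ordLess_ordLeq by blast
      qed
      then show "V \<in> (\<Union>W\<in>T. {V \<in> D. W \<subseteq> V})" using V by blast
    qed
    then have "|D| \<le>o |\<Union>W\<in>T. {V \<in> D. W \<subseteq> V}|" by (rule card_of_mono1)
    also have "|\<Union>W\<in>T. {V \<in> D. W \<subseteq> V}| \<le>o |SIGMA W:T. {V \<in> D. W \<subseteq> V}|"
      by (rule card_of_UNION_Sigma)
    also have "|SIGMA W:T. {V \<in> D. W \<subseteq> V}| \<le>o |T \<times> Pow M|"
      using above T(1) by (intro card_of_Sigma_mono1) blast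
    finally have "|D| \<le>o |T \<times> Pow M|" .
    moreover have "|T| <o lam" using T(2) PPM ordIso_ordLess_trans ordIso_symmetric by blast
    ultimately show ?thesis using small_mono small_Times[OF _ PM] by metis
  qed
  \<comment> \<open>\<open>f x\<close> lists the representatives of \<open>x\<close> modulo every
    member of \<open>D\<close>. As \<open>D\<close> is small, there are few lists, and equal lists
    mean congruence modulo the intersection.\<close>
  define f where "f x = {(V, s). V \<in> D \<and> s \<in> S V \<and> x \<otimes> inv s \<in> V}" for x
  show ?thesis
  proof (rule small_indexI[where f = f])
    have "f ` carrier G \<subseteq> Pow (SIGMA V:D. S V)" by (auto simp: f_def)
    moreover have "|SIGMA V:D. S V| <o lam"
      using small_mono[OF card_of_Sigma_mono1[of D S "\<lambda>_. M"] small_Times[OF D M]] S by blast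
    ultimately show "|f ` carrier G| <o lam" using small_mono[OF card_of_mono1 small_Pow] by blast
    fix x y assume xy: "x \<in> carrier G" "y \<in> carrier G" "f x = f y"
    show "x \<otimes> inv y \<in> \<Inter>D"
    proof
      fix V assume V: "V \<in> D"
      obtain s where s: "s \<in> S V" "x \<otimes> inv s \<in> V" using S[OF V] xy by blast
      then have "(V, s) \<in> f y" using V xy(3) by (auto simp: f_def)
      then have "y \<otimes> inv s \<in> V" by (auto simp: f_def)
      moreover have "s \<in> carrier G" using s S[OF V] by blast
      ultimately show "x \<otimes> inv y \<in> V"
        using rcong_trans[OF sub[OF V]] rcong_sym[OF sub[OF V]] s xy by metis
    qed
  qed
qed

end

section \<open>Complete filtrations\<close>

text \<open>A group that is Hausdorff and complete for the topology in which the normal subgroups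
  \<open>U n\<close> form a base at the identity.\<close>

locale filtered_group = group G
  for G :: "('a, 'm) monoid_scheme" (structure) and U :: "nat \<Rightarrow> 'a set" +
  assumes U_normal: "U n \<lhd> G"
    and U_dec: "U (Suc n) \<subseteq> U n"
    and U_separated: "(\<Inter>n. U n) = {\<one>}"
    and U_complete: "\<lbrakk>range y \<subseteq> carrier G; cauchy U y\<rbrakk> \<Longrightarrow> \<exists>g \<in> carrier G. tends U y g"
begin

lemma U_subgroup: "subgroup (U n) G"
  using U_normal by (rule normal_imp_subgroup)

lemma U_antimono: "m \<le> n \<Longrightarrow> U n \<subseteq> U m"
  using lift_Suc_antimono_le[of U, OF U_dec] .

lemma U_conj: "\<lbrakk>x \<in> U n; g \<in> carrier G\<rbrakk> \<Longrightarrow> g \<otimes> x \<otimes> inv g \<in> U n"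
  using normal.inv_op_closed2[OF U_normal] by blast

text \<open>As \<open>G\<close> is complete for \<open>U\<close>, this is completeness for a filtration \<open>V\<close> finer than \<open>U\<close>; fixing the
  \<open>U\<close>-limit \<open>g\<close> in advance makes it stable under common refinements.\<close>

definition complete :: "(nat \<Rightarrow> 'a set) \<Rightarrow> bool" where
  "complete V \<longleftrightarrow> (\<forall>y g. range y \<subseteq> carrier G \<longrightarrow> g \<in> carrier G \<longrightarrow>
     cauchy V y \<longrightarrow> tends U y g \<longrightarrow> tends V y g)"

lemma completeD:
  "\<lbrakk>complete V; range y \<subseteq> carrier G; g \<in> carrier G; cauchy V y; tends U y g\<rbrakk> \<Longrightarrow> tends V y g"
  by (simp add: complete_def)

lemma cauchy_finer:
  assumes "cauchy W y" "\<And>n. \<exists>m. W m \<subseteq> V n"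
  shows "cauchy V y"
  unfolding cauchy_def
proof
  fix n
  obtain m where m: "W m \<subseteq> V n" using assms(2) by blast
  obtain N where "\<forall>i\<ge>N. \<forall>j\<ge>N. y i \<otimes> inv (y j) \<in> W m"
    using assms(1) unfolding cauchy_def by blast
  then show "\<exists>N. \<forall>i\<ge>N. \<forall>j\<ge>N. y i \<otimes> inv (y j) \<in> V n" using m by blast
qed

end

locale filtered_lam_group = filtered_group G U + lam_group G lam
  for G :: "('a, 'm) monoid_scheme" (structure) and U :: "nat \<Rightarrow> 'a set" and lam :: "'k rel" +
  assumes U_small: "small_index (U n)"

context filtered_lam_group
begin

text \<open>\<open>W\<close> governs convergence and \<open>L\<close> separation. Since
  \<open>W m \<subseteq> L m\<close>, left factors from \<open>W m\<close> do not change the right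
  coset modulo \<open>L m\<close>. The unbounded indices leave room for many cosets, and
  incongruence modulo \<open>L m\<close> implies incongruence modulo \<open>Z\<close>.\<close>

definition separating :: "(nat \<Rightarrow> 'a set) \<Rightarrow> (nat \<Rightarrow> 'a set) \<Rightarrow> 'a set \<Rightarrow> bool" where
  "separating W L Z \<longleftrightarrow> complete W \<and>
     (\<forall>m. subgroup (W m) G \<and> W (Suc m) \<subseteq> W m \<and> small_index (W m) \<and>
       subgroup (L m) G \<and> L (Suc m) \<subseteq> L m \<and> W m \<subseteq> L m \<and> Z \<subseteq> L m) \<and>
     (\<forall>M :: 'k set. |M| <o lam \<longrightarrow> (\<exists>m. \<not> index_le (L m) M))"

lemma separatingD:
  assumes "separating W L Z"
  shows "complete W" "subgroup (W m) G" "W (Suc m) \<subseteq> W m" "small_index (W m)"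
    "subgroup (L m) G" "L (Suc m) \<subseteq> L m" "W m \<subseteq> L m" "Z \<subseteq> L m"
    and "\<And>M :: 'k set. |M| <o lam \<Longrightarrow> \<exists>m. \<not> index_le (L m) M"
  using assms unfolding separating_def by (elim conjE; simp)+

end

section \<open>Filtrations adapted to the image of one homomorphism\<close>

locale filtered_lam_hom = filtered_lam_group G U lam + H: filtered_group H N
  for G :: "('a, 'm) monoid_scheme" (structure) and U :: "nat \<Rightarrow> 'a set" and lam :: "'k rel"
    and H :: "('b, 'n) monoid_scheme" and N :: "nat \<Rightarrow> 'b set" +
  fixes \<sigma> :: "'b \<Rightarrow> 'a"
  assumes \<sigma>_hom: "\<sigma> \<in> hom H G"
    and \<sigma>_filtered: "\<sigma> ` N n \<subseteq> U n"
    and image_large: "\<not> small_index (\<sigma> ` carrier H)"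
begin

abbreviation K :: "nat \<Rightarrow> 'a set" where "K n \<equiv> \<sigma> ` N n"

lemma group_hom: "group_hom H G \<sigma>"
  by (simp add: group_hom_def group_hom_axioms_def \<sigma>_hom H.is_group is_group)

lemma K_subgroup: "subgroup (K n) G"
  using group_hom.subgroup_img_is_subgroup[OF group_hom H.U_subgroup] .

lemma N_carrier: "h \<in> N n \<Longrightarrow> h \<in> carrier H"
  using subgroup.mem_carrier[OF H.U_subgroup] .

lemma K_carrier: "k \<in> K n \<Longrightarrow> k \<in> carrier G"
  using subgroup.mem_carrier[OF K_subgroup] .

lemma K_conj:
  assumes "k \<in> \<sigma> ` carrier H" "x \<in> K n"
  shows "k \<otimes> x \<otimes> inv k \<in> K n"
proof -
  obtain g h where gh: "g \<in> carrier H" "k = \<sigma> g" "h \<in> N n" "x = \<sigma> h" using assms by blast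
  have hc: "h \<in> carrier H" using gh(3) N_carrier by blast
  have "g \<otimes>\<^bsub>H\<^esub> h \<otimes>\<^bsub>H\<^esub> inv\<^bsub>H\<^esub> g \<in> N n" using H.U_conj gh by blast
  moreover have "\<sigma> (g \<otimes>\<^bsub>H\<^esub> h \<otimes>\<^bsub>H\<^esub> inv\<^bsub>H\<^esub> g) = k \<otimes> x \<otimes> inv k"
    using gh hc group_hom.hom_mult[OF group_hom] group_hom.hom_inv[OF group_hom] by simp
  ultimately show ?thesis by (metis imageI)
qed

text \<open>Small index is left out: the conditions listed survive nonempty intersections and
  closures, so small index is the only thing that refinement can destroy.\<close>

definition good :: "(nat \<Rightarrow> 'a set) \<Rightarrow> bool" where
  "good V \<longleftrightarrow> complete V \<and> (\<forall>n. subgroup (V n) G \<and> V (Suc n) \<subseteq> V n \<and> K n \<subseteq> V n \<and> V n \<subseteq> U n \<and>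
     (\<forall>k \<in> \<sigma> ` carrier H. \<forall>v \<in> V n. k \<otimes> v \<otimes> inv k \<in> V n))"

lemma goodI:
  assumes "complete V" "\<And>n. subgroup (V n) G" "\<And>n. V (Suc n) \<subseteq> V n" "\<And>n. K n \<subseteq> V n"
    and "\<And>n. V n \<subseteq> U n"
    and "\<And>n k v. \<lbrakk>k \<in> \<sigma> ` carrier H; v \<in> V n\<rbrakk> \<Longrightarrow> k \<otimes> v \<otimes> inv k \<in> V n"
  shows "good V"
  unfolding good_def by (intro conjI allI ballI assms)

lemma goodD:
  assumes "good V"
  shows "complete V" "subgroup (V n) G" "V (Suc n) \<subseteq> V n" "K n \<subseteq> V n" "V n \<subseteq> U n"
    and "\<lbrakk>k \<in> \<sigma> ` carrier H; v \<in> V n\<rbrakk> \<Longrightarrow> k \<otimes> v \<otimes> inv k \<in> V n"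
  using assms unfolding good_def by blast+

lemma good_U: "good U"
proof (rule goodI)
  show "k \<otimes> v \<otimes> inv k \<in> U n" if "k \<in> \<sigma> ` carrier H" "v \<in> U n" for n k v
    using that \<sigma>_hom by (intro U_conj) (auto simp: hom_def)
qed (simp_all add: complete_def U_subgroup U_dec \<sigma>_filtered)

text \<open>For completeness, the limit may be approached at different speeds in different
  \<open>V\<close>. The bound from the Cauchy condition for the intersection serves all of them:
  compare with one later term, chosen for each \<open>V\<close>.\<close>

lemma good_Inter:
  assumes ne: "C \<noteq> {}" and C: "\<And>V. V \<in> C \<Longrightarrow> good V"
  shows "good (\<lambda>n. \<Inter>V\<in>C. V n)"
proof -
  have "complete (\<lambda>n. \<Inter>V\<in>C. V n)"
    unfolding complete_def
  proof (intro allI impI)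
    fix y g assume y: "range y \<subseteq> carrier G" and g: "g \<in> carrier G"
      and c: "cauchy (\<lambda>n. \<Inter>V\<in>C. V n) y" and t: "tends U y g"
    show "tends (\<lambda>n. \<Inter>V\<in>C. V n) y g"
      unfolding tends_def
    proof
      fix n
      obtain M where M: "\<forall>i\<ge>M. \<forall>j\<ge>M. y i \<otimes> inv (y j) \<in> (\<Inter>V\<in>C. V n)"
        using c unfolding cauchy_def by blast
      have "g \<otimes> inv (y j) \<in> V n" if V: "V \<in> C" and j: "j \<ge> M" for V j
      proof -
        have "cauchy V y" using V by (intro cauchy_finer[OF c]) blast
        then have "tends V y g" using completeD[OF goodD(1)[OF C[OF V]] y g _ t] by blast
        then obtain M' where "\<forall>i\<ge>M'. g \<otimes> inv (y i) \<in> V n" unfolding tends_def by blast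
        then have "g \<otimes> inv (y (max M M')) \<in> V n" by simp
        moreover have "y (max M M') \<otimes> inv (y j) \<in> V n" using M V j by simp
        ultimately show ?thesis
          using rcong_trans[OF goodD(2)[OF C[OF V]] g] y by (meson range_subsetD)
      qed
      then show "\<exists>M. \<forall>j\<ge>M. g \<otimes> inv (y j) \<in> (\<Inter>V\<in>C. V n)" by blast
    qed
  qed
  moreover have "subgroup (\<Inter>V\<in>C. V n) G" for n
    using ne C by (intro subgroups_Inter) (auto simp: goodD(2))
  moreover have "(\<Inter>V\<in>C. V (Suc n)) \<subseteq> (\<Inter>V\<in>C. V n)" for n
    using goodD(3)[OF C] by blast
  moreover have "K n \<subseteq> (\<Inter>V\<in>C. V n)" for n
    using goodD(4)[OF C] by blast
  moreover have "(\<Inter>V\<in>C. V n) \<subseteq> U n" for n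
    using goodD(5)[OF C] ne by blast
  moreover have "k \<otimes> v \<otimes> inv k \<in> (\<Inter>V\<in>C. V n)"
    if "k \<in> \<sigma> ` carrier H" "v \<in> (\<Inter>V\<in>C. V n)" for k v n
    using goodD(6)[OF C] that by blast
  ultimately show ?thesis by (rule goodI)
qed

text \<open>The topological closure of \<open>K n\<close> when the \<open>V m\<close> form a base at
  the identity.\<close>

definition closure :: "(nat \<Rightarrow> 'a set) \<Rightarrow> nat \<Rightarrow> 'a set" where
  "closure V n = (\<Inter>m. K n <#> V m)"

lemma K_image: "k \<in> K n \<Longrightarrow> k \<in> \<sigma> ` carrier H"
  using N_carrier by blast

lemma subgroup_K_mult:
  assumes "good V" shows "subgroup (K n <#> V m) G"
  by (intro subgroup_set_mult K_subgroup goodD[OF assms] K_image)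

lemma closure_subset:
  assumes "good V" shows "closure V n \<subseteq> V n"
proof -
  have "K n <#> V n \<subseteq> V n"
    using subgroup.m_closed[OF goodD(2)[OF assms]] goodD(4)[OF assms] unfolding set_mult_def by blast
  then show ?thesis by (auto simp: closure_def)
qed

text \<open>Completeness holds because closed subgroups contain limits: if late quotients lie in
  every \<open>K n <#> V m\<close>, so do the quotients with the \<open>V\<close>-limit. Invariance
  follows by conjugating the two factors separately.\<close>

lemma good_closure:
  assumes V: "good V"
  shows "good (closure V)"
proof -
  have Vs: "subgroup (V m) G" for m using goodD(2)[OF V] .
  have sub: "subgroup (closure V n) G" for n
    unfolding closure_def using subgroup_K_mult[OF V] by (intro subgroups_Inter) auto
  have "complete (closure V)"
    unfolding complete_def
  proof (intro allI impI)
    fix y g assume y: "range y \<subseteq> carrier G" and g: "g \<in> carrier G"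
      and c: "cauchy (closure V) y" and t: "tends U y g"
    have yc: "y j \<in> carrier G" for j using y by blast
    have "cauchy V y" using closure_subset[OF V] by (intro cauchy_finer[OF c]) blast
    then have tV: "tends V y g" using completeD[OF goodD(1)[OF V] y g _ t] by blast
    show "tends (closure V) y g"
      unfolding tends_def
    proof
      fix n
      obtain M where M: "\<forall>i\<ge>M. \<forall>j\<ge>M. y i \<otimes> inv (y j) \<in> closure V n"
        using c unfolding cauchy_def by blast
      have "g \<otimes> inv (y j) \<in> K n <#> V m" if j: "j \<ge> M" for j m
      proof -
        obtain M' where "\<forall>i\<ge>M'. g \<otimes> inv (y i) \<in> V m" using tV unfolding tends_def by blast
        then have "g \<otimes> inv (y (max M M')) \<in> K n <#> V m"
          using subset_set_mult_right[OF K_subgroup Vs] by (meson max.cobounded2 subsetD)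
        moreover have "y (max M M') \<otimes> inv (y j) \<in> K n <#> V m"
          using M j by (auto simp: closure_def)
        ultimately show ?thesis
          using rcong_trans[OF subgroup_K_mult[OF V] g yc yc] by blast
      qed
      then show "\<exists>M. \<forall>j\<ge>M. g \<otimes> inv (y j) \<in> closure V n" by (auto simp: closure_def)
    qed
  qed
  moreover have "closure V (Suc n) \<subseteq> closure V n" for n
    unfolding closure_def using set_mult_mono[OF image_mono[OF H.U_dec] order_refl] by blast
  moreover have "K n \<subseteq> closure V n" for n
    unfolding closure_def using subset_set_mult_left[OF K_subgroup Vs] by blast
  moreover have "closure V n \<subseteq> U n" for n
    using closure_subset[OF V] goodD(5)[OF V] by blast
  moreover have "k \<otimes> v \<otimes> inv k \<in> closure V n"
    if k: "k \<in> \<sigma> ` carrier H" and v: "v \<in> closure V n" for k v n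
    unfolding closure_def
  proof
    fix m
    have kc: "k \<in> carrier G" using k \<sigma>_hom by (auto simp: hom_def)
    have "v \<in> K n <#> V m" using v by (auto simp: closure_def)
    then obtain a b where ab: "a \<in> K n" "b \<in> V m" "v = a \<otimes> b" unfolding set_mult_def by blast
    have c: "a \<in> carrier G" "b \<in> carrier G" using ab K_carrier subgroup.mem_carrier[OF Vs] by blast+
    have "(k \<otimes> a \<otimes> inv k) \<otimes> (k \<otimes> b \<otimes> inv k) = k \<otimes> v \<otimes> inv k"
    proof -
      have "inv k \<otimes> (k \<otimes> (b \<otimes> inv k)) = b \<otimes> inv k"
        using kc c by (simp add: m_assoc[symmetric])
      then show ?thesis using kc c ab by (simp add: m_assoc)
    qed
    moreover have "k \<otimes> a \<otimes> inv k \<in> K n" using K_conj k ab by blast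
    moreover have "k \<otimes> b \<otimes> inv k \<in> V m" using goodD(6)[OF V k] ab by blast
    ultimately show "k \<otimes> v \<otimes> inv k \<in> K n <#> V m" unfolding set_mult_def by blast
  qed
  ultimately show ?thesis by (rule goodI[OF _ sub])
qed

text \<open>The successive approximation argument of the open mapping theorem.\<close>

lemma closed_under_closure_subset_image:
  assumes V: "good V" and cl: "closure V = V"
  shows "V 0 \<subseteq> \<sigma> ` carrier H"
proof
  fix g assume g: "g \<in> V 0"
  have Vc: "v \<in> carrier G" if "v \<in> V n" for v n
    using that subgroup.mem_carrier[OF goodD(2)[OF V]] by blast
  \<comment> \<open>As \<open>V\<close> equals its closure, \<open>V j\<close> lies in
    \<open>K j <#> V (Suc j)\<close>: an element of \<open>K j\<close> approximates \<open>r\<close>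
    with an error one level deeper.\<close>
  have "\<exists>h r'. h \<in> N j \<and> r' \<in> V (Suc j) \<and> r = \<sigma> h \<otimes> r'" if "r \<in> V j" for j r
  proof -
    have "r \<in> closure V j" using that cl by simp
    then have "r \<in> K j <#> V (Suc j)" unfolding closure_def by (rule INT_D) simp
    then show ?thesis unfolding set_mult_def by blast
  qed
  then have "\<forall>j r. \<exists>h r'. r \<in> V j \<longrightarrow> h \<in> N j \<and> r' \<in> V (Suc j) \<and> r = \<sigma> h \<otimes> r'" by blast
  then obtain F R where FR: "\<And>j r. r \<in> V j \<Longrightarrow> F j r \<in> N j \<and> R j r \<in> V (Suc j) \<and> r = \<sigma> (F j r) \<otimes> R j r"
    unfolding choice_iff by blast
  define r where "r = rec_nat g R"
  have r_in: "r j \<in> V j" for j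
    by (induction j) (use g FR in \<open>auto simp: r_def\<close>)
  define h where "h j = F j (r j)" for j
  have h: "h j \<in> N j" "r j = \<sigma> (h j) \<otimes> r (Suc j)" for j
    using FR[OF r_in[of j]] by (auto simp: h_def r_def)
  have hc: "h j \<in> carrier H" for j using h N_carrier by blast
  \<comment> \<open>The partial products of the \<open>h j\<close> converge in \<open>H\<close>:
    appending \<open>h j\<close> changes \<open>p j\<close> by a conjugate of \<open>h j\<close>,
    which stays in the normal subgroup \<open>N j\<close>.\<close>
  define p where "p = rec_nat \<one>\<^bsub>H\<^esub> (\<lambda>j q. q \<otimes>\<^bsub>H\<^esub> h j)"
  have p_Suc: "p (Suc j) = p j \<otimes>\<^bsub>H\<^esub> h j" and p_0: "p 0 = \<one>\<^bsub>H\<^esub>" for j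
    by (auto simp: p_def)
  have pc: "p j \<in> carrier H" for j
    by (induction j) (auto simp: p_Suc p_0 hc)
  have p_tail: "p i \<otimes>\<^bsub>H\<^esub> inv\<^bsub>H\<^esub> p n \<in> N n" if "n \<le> i" for i n
    using that
  proof (induction i rule: dec_induct)
    case base
    then show ?case using subgroup.one_closed[OF H.U_subgroup] pc by simp
  next
    case (step i)
    have "h i \<in> N n" using h(1) H.U_antimono[OF step(1)] by blast
    then have "p (Suc i) \<otimes>\<^bsub>H\<^esub> inv\<^bsub>H\<^esub> p i \<in> N n" using H.U_conj pc by (simp add: p_Suc)
    then show ?case using H.rcong_trans[OF H.U_subgroup pc pc pc] step by blast
  qed
  have "H.cauchy N p"
    unfolding H.cauchy_def
  proof (intro allI exI impI)
    fix n i j :: nat assume i: "n \<le> i" and j: "n \<le> j"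
    show "p i \<otimes>\<^bsub>H\<^esub> inv\<^bsub>H\<^esub> p j \<in> N n"
      using H.rcong_trans[OF H.U_subgroup pc pc pc p_tail[OF i]
          H.rcong_sym[OF H.U_subgroup pc pc p_tail[OF j]]] .
  qed
  then obtain q where q: "q \<in> carrier H" "H.tends N p q"
    using H.U_complete pc by blast
  have sc: "\<sigma> x \<in> carrier G" if "x \<in> carrier H" for x using that \<sigma>_hom by (auto simp: hom_def)
  \<comment> \<open>After \<open>j\<close> steps the image of the partial product misses
    \<open>g\<close> exactly by the error \<open>r j\<close>.\<close>
  have gp: "g = \<sigma> (p j) \<otimes> r j" for j
  proof (induction j)
    case 0
    then show ?case using Vc[OF g] group_hom.hom_one[OF group_hom] by (simp add: p_0 r_def)
  next
    case (Suc j)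
    have "g = \<sigma> (p j) \<otimes> (\<sigma> (h j) \<otimes> r (Suc j))" using Suc h(2) by metis
    also have "\<dots> = \<sigma> (p (Suc j)) \<otimes> r (Suc j)"
      using sc pc hc Vc[OF r_in] group_hom.hom_mult[OF group_hom] by (simp add: p_Suc m_assoc)
    finally show ?case .
  qed
  \<comment> \<open>Modulo \<open>U n\<close> and for late \<open>j\<close>, \<open>g\<close> agrees
    with \<open>\<sigma> (p j)\<close> because the error lies in \<open>U j\<close>, and
    \<open>\<sigma> (p j)\<close> agrees with \<open>\<sigma> q\<close> because
    \<open>\<sigma>\<close> respects the filtrations.\<close>
  have "g \<otimes> inv (\<sigma> q) \<in> U n" for n
  proof -
    obtain M where M: "\<forall>j\<ge>M. q \<otimes>\<^bsub>H\<^esub> inv\<^bsub>H\<^esub> p j \<in> N n" using q(2) unfolding H.tends_def by blast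
    define j where "j = max M n"
    have "q \<otimes>\<^bsub>H\<^esub> inv\<^bsub>H\<^esub> p j \<in> N n" using M by (simp add: j_def)
    then have "\<sigma> (q \<otimes>\<^bsub>H\<^esub> inv\<^bsub>H\<^esub> p j) \<in> U n" using \<sigma>_filtered by blast
    then have "\<sigma> q \<otimes> inv (\<sigma> (p j)) \<in> U n"
      using q pc group_hom.hom_mult[OF group_hom] group_hom.hom_inv[OF group_hom] by simp
    then have 1: "\<sigma> (p j) \<otimes> inv (\<sigma> q) \<in> U n" using rcong_sym[OF U_subgroup] sc pc q by blast
    have "r j \<in> U j" using r_in goodD(5)[OF V] by blast
    then have "r j \<in> U n" using U_antimono[of n j] by (auto simp: j_def)
    then have "g \<otimes> inv (\<sigma> (p j)) \<in> U n" using U_conj[of "r j" n "\<sigma> (p j)"] sc pc gp[of j] by simp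
    then show ?thesis using 1 rcong_trans[OF U_subgroup] sc pc q Vc[OF g] by blast
  qed
  then have "g \<otimes> inv (\<sigma> q) = \<one>" using U_separated by blast
  then have "g = \<sigma> q" using sc[OF q(1)] Vc[OF g] by (metis inv_equality inv_closed inv_inv)
  then show "g \<in> \<sigma> ` carrier H" using q(1) by blast
qed

end

section \<open>Separating sequences from the breakdown of refinement\<close>

context filtered_lam_hom
begin

text \<open>If one small cardinal bounded the index of every \<open>K n <#> V m\<close>, then
  \<open>small_index_Inter_chain\<close> would make the index of their intersection, the closure,
  small.\<close>

lemma separating_closure:
  assumes V: "good V" and small: "\<And>m. small_index (V m)" and large: "\<not> small_index (closure V n)"
  shows "separating V (\<lambda>m. K n <#> V m) (K n)"
  unfolding separating_def
proof (intro conjI allI impI)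
  show dec: "K n <#> V (Suc m) \<subseteq> K n <#> V m" for m
    using set_mult_mono[OF order_refl goodD(3)[OF V]] .
  show "\<exists>m. \<not> index_le (K n <#> V m) M" if M: "|M| <o lam" for M :: "'k set"
  proof (rule ccontr)
    assume "\<not> ?thesis"
    then have idx: "index_le (K n <#> V m) M" for m by simp
    have anti: "K n <#> V j \<subseteq> K n <#> V i" if "i \<le> j" for i j
      using lift_Suc_antimono_le[of "\<lambda>m. K n <#> V m", OF dec that] .
    have "small_index (\<Inter>(range (\<lambda>m. K n <#> V m)))"
    proof (rule small_index_Inter_chain[OF _ _ _ M])
      fix A B assume "A \<in> range (\<lambda>m. K n <#> V m)" "B \<in> range (\<lambda>m. K n <#> V m)"
      then obtain i j where "A = K n <#> V i" "B = K n <#> V j" by blast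
      then show "A \<subseteq> B \<or> B \<subseteq> A" using anti nat_le_linear[of i j] by blast
    qed (use idx subgroup_K_mult[OF V] in auto)
    then show False using large by (simp add: closure_def)
  qed
qed (fact goodD[OF V] small subgroup_K_mult[OF V] subset_set_mult_left[OF K_subgroup goodD(2)[OF V]]
  subset_set_mult_right[OF K_subgroup goodD(2)[OF V]])+

text \<open>The indices at level \<open>n\<close> are unbounded along the chain, as otherwise the
  intersection would have small index. Countably many members witness this, and a diagonal through a
  decreasing sequence of members is again complete.\<close>

lemma separating_chain:
  assumes ne: "C \<noteq> {}" and C: "\<And>V. V \<in> C \<Longrightarrow> good V" "\<And>V m. V \<in> C \<Longrightarrow> small_index (V m)"
    and chain: "\<And>V W. V \<in> C \<Longrightarrow> W \<in> C \<Longrightarrow> (\<forall>m. V m \<subseteq> W m) \<or> (\<forall>m. W m \<subseteq> V m)"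
    and large: "\<not> small_index (\<Inter>V\<in>C. V n)"
  shows "\<exists>W L. separating W L (K n)"
proof -
  obtain A :: "nat \<Rightarrow> 'k set" where A: "\<And>n. |A n| <o lam"
    "\<And>M :: 'k set. |M| <o lam \<Longrightarrow> \<exists>n. |M| \<le>o |A n|"
    using exhaustion by metis
  have "\<exists>V \<in> C. \<not> index_le (V n) (A m)" for m
  proof (rule ccontr)
    assume "\<not> ?thesis"
    then have idx: "index_le (V n) (A m)" if "V \<in> C" for V using that by blast
    have "small_index (\<Inter>((\<lambda>V. V n) ` C))"
    proof (rule small_index_Inter_chain[OF _ _ _ A(1)])
      show "B \<subseteq> D \<or> D \<subseteq> B" if "B \<in> (\<lambda>V. V n) ` C" "D \<in> (\<lambda>V. V n) ` C" for B D
        using that chain by blast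
    qed (use ne idx goodD(2)[OF C(1)] in auto)
    then show False using large by simp
  qed
  then obtain X where X: "\<And>m. X m \<in> C" "\<And>m. \<not> index_le (X m n) (A m)" by metis
  \<comment> \<open>Switching to \<open>X (Suc m)\<close> only when it is finer makes
    \<open>Y\<close> decrease; otherwise comparability in \<open>C\<close> puts the current member
    inside it already.\<close>
  define Y where "Y = rec_nat (X 0) (\<lambda>m V. if \<forall>i. X (Suc m) i \<subseteq> V i then X (Suc m) else V)"
  have Y_0: "Y 0 = X 0"
    and Y_Suc: "Y (Suc m) = (if \<forall>i. X (Suc m) i \<subseteq> Y m i then X (Suc m) else Y m)" for m
    by (simp_all add: Y_def)
  have YC: "Y m \<in> C" for m
    by (induction m) (simp_all add: Y_0 Y_Suc X(1))
  have Y_dec: "Y (Suc m) i \<subseteq> Y m i" for m i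
    by (simp add: Y_Suc)
  have Y_X: "Y m i \<subseteq> X m i" for m i
  proof (cases m)
    case (Suc l)
    then show ?thesis using chain[OF X(1)[of "Suc l"] YC[of l]] by (auto simp: Y_Suc)
  qed (simp add: Y_0)
  have Y_anti: "Y j i \<subseteq> Y k i" if "k \<le> j" for i j k
    using lift_Suc_antimono_le[of "\<lambda>m. Y m i", OF Y_dec that] .
  note Yg = C(1)[OF YC]
  have Y_anti2: "Y k j \<subseteq> Y k i" if "i \<le> j" for i j k
    using lift_Suc_antimono_le[of "Y k", OF goodD(3)[OF Yg] that] .
  \<comment> \<open>The diagonal is eventually inside each \<open>Y k i\<close>, so its Cauchy
    sequences tend to their \<open>U\<close>-limit in every \<open>Y k\<close>. The
    \<open>max\<close> keeps \<open>W m\<close> inside \<open>Y m n\<close> for \<open>m < n\<close>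
    also.\<close>
  define W where "W m = Y m (max m n)" for m
  have W_sub: "W m \<subseteq> Y k i" if "k \<le> m" "i \<le> m" for m k i
    unfolding W_def using Y_anti[OF that(1)] Y_anti2[of i "max m n"] that(2) by force
  have "separating W (\<lambda>m. Y m n) (K n)"
    unfolding separating_def
  proof (intro conjI allI impI)
    show "complete W"
      unfolding complete_def
    proof (intro allI impI)
      fix y g assume y: "range y \<subseteq> carrier G" and g: "g \<in> carrier G"
        and c: "cauchy W y" and t: "tends U y g"
      have tY: "tends (Y k) y g" for k
      proof (rule completeD[OF goodD(1)[OF Yg] y g _ t])
        show "cauchy (Y k) y"
          using W_sub[of k "max k i" i for i]
          by (intro cauchy_finer[OF c]) (meson max.cobounded1 max.cobounded2)
      qed
      show "tends W y g"
        unfolding tends_def W_def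
      proof
        fix m show "\<exists>N. \<forall>j\<ge>N. g \<otimes> inv y j \<in> Y m (max m n)"
          using tY[of m] unfolding tends_def by blast
      qed
    qed
    show "W (Suc m) \<subseteq> W m" for m
      unfolding W_def using Y_dec[of m] Y_anti2[of "max m n" "max (Suc m) n" m] by force
    show "W m \<subseteq> Y m n" for m unfolding W_def by (rule Y_anti2) simp
    show "\<exists>m. \<not> index_le (Y m n) M" if M: "|M| <o lam" for M :: "'k set"
    proof -
      obtain m where "|M| \<le>o |A m|" using A(2)[OF M] by blast
      then have "\<not> index_le (Y m n) M" using index_le_mono[of "Y m n" M "X m n" "A m"] X(2) Y_X by blast
      then show ?thesis by blast
    qed
  qed (simp_all only: W_def goodD[OF Yg] C(2)[OF YC] Y_dec)
  then show ?thesis by blast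
qed

lemma ex_separating: "\<exists>W L n. separating W L (K n)"
proof (rule ccontr)
  assume none: "\<not> ?thesis"
  define A where "A = {V. good V \<and> (\<forall>n. small_index (V n))}"
  \<comment> \<open>\<open>P\<close> points towards refinement, so Zorn's lemma yields a finest
    filtration in \<open>A\<close>; a chain is bounded by its levelwise intersection.\<close>
  define P where "P V V' \<longleftrightarrow> (\<forall>n. V' n \<subseteq> V n)" for V V' :: "nat \<Rightarrow> 'a set"
  have "\<exists>V \<in> A. \<forall>V' \<in> A. P V V' \<longrightarrow> V' = V"
  proof (rule predicate_Zorn)
    show "partial_order_on A (relation_of P A)"
      by (rule partial_order_on_relation_ofI) (auto simp: P_def fun_eq_iff)
    fix C assume C: "C \<in> Chains (relation_of P A)"
    show "\<exists>u \<in> A. \<forall>V \<in> C. P V u"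
    proof (cases "C = {}")
      case True
      then show ?thesis using good_U U_small by (auto simp: A_def)
    next
      case False
      have CA: "good V" "small_index (V m)" if "V \<in> C" for V m
        using C that by (auto simp: Chains_def relation_of_def A_def)
      have chain: "(\<forall>m. V m \<subseteq> W m) \<or> (\<forall>m. W m \<subseteq> V m)" if "V \<in> C" "W \<in> C" for V W
        using C that by (auto simp: Chains_def relation_of_def P_def)
      have "small_index (\<Inter>V\<in>C. V n)" for n
      proof (rule ccontr)
        assume large: "\<not> ?thesis"
        have "\<exists>W L. separating W L (K n)"
        proof (rule separating_chain[OF False _ _ _ large])
          fix V W assume V: "V \<in> C"
          show "good V" "small_index (V m)" for m using CA[OF V] by blast+
          show "(\<forall>m. V m \<subseteq> W m) \<or> (\<forall>m. W m \<subseteq> V m)" if "W \<in> C" using chain[OF V that] .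
        qed
        then show False using none by blast
      qed
      then have "(\<lambda>n. \<Inter>V\<in>C. V n) \<in> A"
        using good_Inter[OF False] CA by (simp add: A_def)
      moreover have "P V (\<lambda>n. \<Inter>V\<in>C. V n)" if "V \<in> C" for V using that by (auto simp: P_def)
      ultimately show ?thesis by blast
    qed
  qed
  then obtain V where V: "V \<in> A" "\<And>V'. V' \<in> A \<Longrightarrow> P V V' \<Longrightarrow> V' = V" by blast
  then have g: "good V" and small: "\<And>m. small_index (V m)" by (auto simp: A_def)
  have "small_index (closure V n)" for n
  proof (rule ccontr)
    assume "\<not> ?thesis"
    then have "separating V (\<lambda>m. K n <#> V m) (K n)" by (rule separating_closure[OF g small])
    then show False using none by blast
  qed
  then have "closure V \<in> A" using good_closure[OF g] by (simp add: A_def)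
  \<comment> \<open>A finest filtration equals its closure, so its level \<open>0\<close>, which has
    small index, lies in the image, against \<open>image_large\<close>.\<close>
  then have "closure V = V" using V(2) closure_subset[OF g] by (simp add: P_def)
  then have "small_index (\<sigma> ` carrier H)"
    using closed_under_closure_subset_image[OF g] small_index_mono[OF small] by blast
  then show False using image_large by contradiction
qed

end

section \<open>Trees of incongruent elements\<close>

text \<open>By Zorn's lemma. That every element of \<open>X\<close> belongs to \<open>S\<close> or
  is related to a member of it is how lower bounds on the size of \<open>S\<close> are
  obtained.\<close>

lemma maximal_independent:
  assumes sym: "\<And>x y. R x y \<Longrightarrow> R y x"
  obtains S where "S \<subseteq> X" "\<And>x y. x \<in> S \<Longrightarrow> y \<in> S \<Longrightarrow> x \<noteq> y \<Longrightarrow> \<not> R x y"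
    "\<And>x. x \<in> X \<Longrightarrow> x \<in> S \<or> (\<exists>y \<in> S. R x y)"
proof -
  define A where "A = {S. S \<subseteq> X \<and> (\<forall>x\<in>S. \<forall>y\<in>S. x \<noteq> y \<longrightarrow> \<not> R x y)}"
  have "\<exists>S\<in>A. \<forall>T\<in>A. S \<subseteq> T \<longrightarrow> T = S"
  proof (rule subset_Zorn')
    fix C assume C: "subset.chain A C"
    have "\<not> R x y" if x: "x \<in> \<Union>C" and y: "y \<in> \<Union>C" and ne: "x \<noteq> y" for x y
    proof -
      obtain S T where ST: "S \<in> C" "T \<in> C" "x \<in> S" "y \<in> T" using x y by blast
      then consider "S \<subseteq> T" | "T \<subseteq> S" using C unfolding subset_chain_def by blast
      then obtain B where "B \<in> C" "x \<in> B" "y \<in> B" using ST by cases blast+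
      then show ?thesis using C ne unfolding subset_chain_def A_def by blast
    qed
    then show "\<Union>C \<in> A" using C by (auto simp: subset_chain_def A_def)
  qed
  then obtain S where S: "S \<in> A" and max: "\<And>T. T \<in> A \<Longrightarrow> S \<subseteq> T \<Longrightarrow> T = S" by blast
  show thesis
  proof (rule that)
    show "S \<subseteq> X" using S by (simp add: A_def)
    show "\<not> R x y" if "x \<in> S" "y \<in> S" "x \<noteq> y" for x y using S that by (simp add: A_def)
    show "x \<in> S \<or> (\<exists>y \<in> S. R x y)" if x: "x \<in> X" for x
    proof (rule ccontr)
      assume *: "\<not> ?thesis"
      then have "insert x S \<in> A" using S x sym by (auto simp: A_def)
      then show False using max[of "insert x S"] * by blast
    qed
  qed
qed

section \<open>Common refinement and a tree for finitely many homomorphisms\<close>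

context filtered_lam_group
begin

context
  fixes I :: "'i set" and W L :: "'i \<Rightarrow> nat \<Rightarrow> 'a set" and Z :: "'i \<Rightarrow> 'a set"
  assumes fin: "finite I" and ne: "I \<noteq> {}"
    and sep: "\<And>t. t \<in> I \<Longrightarrow> separating (W t) (L t) (Z t)"
begin

text \<open>The common refinement; finiteness of \<open>I\<close> keeps its indices small and lets
  convergence be tested on each \<open>W t\<close> separately.\<close>

definition V :: "nat \<Rightarrow> 'a set" where "V m = U m \<inter> (\<Inter>t\<in>I. W t m)"

lemma V_subgroup: "subgroup (V m) G"
proof -
  have "V m = \<Inter>(insert (U m) ((\<lambda>t. W t m) ` I))" by (auto simp: V_def)
  moreover have "subgroup (\<Inter>(insert (U m) ((\<lambda>t. W t m) ` I))) G"
    using U_subgroup separatingD(2)[OF sep] by (intro subgroups_Inter) auto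
  ultimately show ?thesis by simp
qed

lemma V_carrier: "x \<in> V m \<Longrightarrow> x \<in> carrier G"
  using subgroup.mem_carrier[OF V_subgroup] .

lemma V_antimono: "m \<le> n \<Longrightarrow> V n \<subseteq> V m"
proof (rule lift_Suc_antimono_le)
  show "V (Suc n) \<subseteq> V n" for n
    using U_dec[of n] separatingD(3)[OF sep] unfolding V_def by blast
qed

lemma L_antimono: "t \<in> I \<Longrightarrow> m \<le> n \<Longrightarrow> L t n \<subseteq> L t m"
  using lift_Suc_antimono_le[of "L t", OF separatingD(6)[OF sep]] .

lemma V_subset_L: "t \<in> I \<Longrightarrow> V m \<subseteq> L t m"
  using separatingD(7)[OF sep] unfolding V_def by blast

lemma V_small: "small_index (V m)"
proof -
  have "subgroup (U m \<inter> (\<Inter>t\<in>J. W t m)) G \<and> small_index (U m \<inter> (\<Inter>t\<in>J. W t m))" if "J \<subseteq> I" for J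
    using finite_subset[OF that fin] that
  proof (induction J rule: finite_induct)
    case empty
    then show ?case using U_subgroup U_small by simp
  next
    case (insert t J)
    have "U m \<inter> (\<Inter>s\<in>insert t J. W s m) = (U m \<inter> (\<Inter>s\<in>J. W s m)) \<inter> W t m" by auto
    moreover have "subgroup (W t m) G" "small_index (W t m)"
      using separatingD(2,4)[OF sep] insert.prems by blast+
    ultimately show ?case
      using insert.IH insert.prems small_index_Int subgroups_Inter_pair by auto
  qed
  then show ?thesis unfolding V_def by blast
qed

text \<open>Here it matters that \<open>complete\<close> fixes the limit in advance: the
  \<open>U\<close>-limit is then the limit for all \<open>W t\<close> at once.\<close>

lemma V_complete:
  assumes y: "range y \<subseteq> carrier G" and c: "cauchy V y"
  obtains g where "g \<in> carrier G" "tends V y g"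
proof -
  have "cauchy U y" by (rule cauchy_finer[OF c]) (auto simp: V_def)
  then obtain g where g: "g \<in> carrier G" "tends U y g" using U_complete[OF y] by blast
  have tW: "tends (W t) y g" if t: "t \<in> I" for t
  proof (rule completeD[OF separatingD(1)[OF sep[OF t]] y g(1) _ g(2)])
    show "cauchy (W t) y" using t by (intro cauchy_finer[OF c]) (auto simp: V_def)
  qed
  have "tends V y g"
    unfolding tends_def
  proof
    fix n
    obtain N0 where N0: "\<forall>j\<ge>N0. g \<otimes> inv (y j) \<in> U n" using g(2) unfolding tends_def by blast
    have "\<forall>t. \<exists>N. t \<in> I \<longrightarrow> (\<forall>j\<ge>N. g \<otimes> inv (y j) \<in> W t n)" using tW unfolding tends_def by blast
    then obtain N where N: "\<And>t. t \<in> I \<Longrightarrow> \<forall>j\<ge>N t. g \<otimes> inv (y j) \<in> W t n" unfolding choice_iff by blast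
    have "g \<otimes> inv (y j) \<in> V n" if j: "j \<ge> Max (insert N0 (N ` I))" for j
    proof -
      have "N0 \<le> j" "\<And>t. t \<in> I \<Longrightarrow> N t \<le> j" using j fin by auto
      then show ?thesis using N0 N unfolding V_def by blast
    qed
    then show "\<exists>N. \<forall>j\<ge>N. g \<otimes> inv (y j) \<in> V n" by blast
  qed
  then show thesis using that g(1) by blast
qed

text \<open>B. H. Neumann's argument: were a coset of \<open>L a m\<close> covered by cosets of the other subgroups,
  its translates would be too, and \<open>L a m\<close> could be dropped from the covering.\<close>

lemma not_covered:
  fixes M :: "'k set"
  assumes "J \<subseteq> I" "|M| <o lam"
  shows "\<exists>m. \<forall>S \<subseteq> V k. |S| \<le>o |M| \<longrightarrow> \<not> (\<forall>x \<in> V k. \<exists>t \<in> J. \<exists>s \<in> S. x \<otimes> inv s \<in> L t m)"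
  using finite_subset[OF assms(1) fin] assms
proof (induction J arbitrary: M rule: finite_induct)
  case empty
  then show ?case using subgroup.one_closed[OF V_subgroup] by blast
next
  case (insert a J)
  have a: "a \<in> I" and J: "J \<subseteq> I" using insert.prems by auto
  obtain T where T: "T \<subseteq> carrier G" "|T| <o lam" "\<forall>x \<in> carrier G. \<exists>s \<in> T. x \<otimes> inv s \<in> V k"
    using small_indexE[OF V_small[of k]] .
  \<comment> \<open>\<open>M1\<close> counts translates of cosets by representatives of
    \<open>G\<close> modulo \<open>V k\<close>; \<open>M2\<close> counts the representatives after
    the cosets of \<open>L a m\<close> have been replaced.\<close>
  obtain M1 :: "'k set" where M1: "|M \<times> T| =o |M1|" "|M1| <o lam"
    using small_copy[OF small_Times[OF insert.prems(2) T(2)]] .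
  obtain M2 :: "'k set" where M2: "|M <+> M \<times> M| =o |M2|" "|M2| <o lam"
    using small_copy[OF card_of_Plus_ordLess_infinite_Field[OF infinite_lam card_lam
          insert.prems(2) small_Times[OF insert.prems(2) insert.prems(2)]]] .
  obtain m1 where m1: "\<And>S. S \<subseteq> V k \<Longrightarrow> |S| \<le>o |M2| \<Longrightarrow>
      \<not> (\<forall>x \<in> V k. \<exists>t \<in> J. \<exists>s \<in> S. x \<otimes> inv s \<in> L t m1)"
    using insert.IH[OF J M2(2)] by blast
  obtain m2 where m2: "\<not> index_le (L a m2) M1" using separatingD(9)[OF sep[OF a] M1(2)] by blast
  define m where "m = max m1 m2"
  have La: "subgroup (L a m) G" using separatingD(5)[OF sep[OF a]] .
  have "\<not> (\<forall>x \<in> V k. \<exists>t \<in> insert a J. \<exists>s \<in> S. x \<otimes> inv s \<in> L t m)"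
    if S: "S \<subseteq> V k" "|S| \<le>o |M|" for S
  proof
    assume cov: "\<forall>x \<in> V k. \<exists>t \<in> insert a J. \<exists>s \<in> S. x \<otimes> inv s \<in> L t m"
    have Sc: "s \<in> carrier G" if "s \<in> S" for s using that S(1) V_carrier by blast
    \<comment> \<open>Otherwise at most \<open>|M|\<close> cosets of \<open>L a m\<close> would
      cover \<open>V k\<close>, and at most \<open>|M \<times> T|\<close> the whole group, against
      the choice of \<open>m2\<close>.\<close>
    have "\<exists>x \<in> V k. \<forall>s \<in> S. x \<otimes> inv s \<notin> L a m"
    proof (rule ccontr)
      assume "\<not> ?thesis"
      then have cov_a: "\<exists>s \<in> S. x \<otimes> inv s \<in> L a m" if "x \<in> V k" for x using that by blast
      have "index_le (L a m) M1"
        unfolding index_le_def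
      proof (intro exI conjI ballI)
        let ?S = "(\<lambda>(s, u). s \<otimes> u) ` (S \<times> T)"
        show "?S \<subseteq> carrier G" using Sc T(1) by auto
        have "|?S| \<le>o |S \<times> T|" by (rule card_of_image)
        also have "|S \<times> T| \<le>o |M \<times> T|" using S(2) by (rule card_of_Times_mono1)
        also have "|M \<times> T| =o |M1|" by (rule M1(1))
        finally show "|?S| \<le>o |M1|" .
        fix g assume g: "g \<in> carrier G"
        obtain u where u: "u \<in> T" "g \<otimes> inv u \<in> V k" using T(3) g by blast
        obtain s where s: "s \<in> S" "g \<otimes> inv u \<otimes> inv s \<in> L a m" using cov_a[OF u(2)] by blast
        have "g \<otimes> inv (s \<otimes> u) = g \<otimes> inv u \<otimes> inv s"
          using g Sc[OF s(1)] u T(1) by (simp add: inv_mult_group m_assoc subset_iff)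
        then show "\<exists>s \<in> ?S. g \<otimes> inv s \<in> L a m" using s u by force
      qed
      then have "index_le (L a m2) M1"
        using L_antimono[OF a, of m2 m] ordLeq_refl[OF card_of_Card_order] index_le_mono
        by (metis m_def max.cobounded2)
      then show False using m2 by contradiction
    qed
    then obtain x where x: "x \<in> V k" "\<And>s. s \<in> S \<Longrightarrow> x \<otimes> inv s \<notin> L a m" by blast
    have xc: "x \<in> carrier G" using V_carrier x(1) .
    define S' where "S' = S \<union> (\<lambda>(s, r). s \<otimes> inv x \<otimes> r) ` (S \<times> S)"
    have "S' \<subseteq> V k"
      using S(1) x(1) subgroup.m_closed[OF V_subgroup] subgroup.m_inv_closed[OF V_subgroup]
      by (auto simp: S'_def subset_iff)
    moreover have "|S'| \<le>o |M2|"
    proof -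
      have "|S'| \<le>o |S <+> (\<lambda>(s, r). s \<otimes> inv x \<otimes> r) ` (S \<times> S)|"
        unfolding S'_def by (rule card_of_Un_Plus_ordLeq)
      also have "|S <+> (\<lambda>(s, r). s \<otimes> inv x \<otimes> r) ` (S \<times> S)| \<le>o |S <+> S \<times> S|"
        by (rule card_of_Plus_mono2[OF card_of_image])
      also have "|S <+> S \<times> S| \<le>o |M <+> S \<times> S|"
        using S(2) by (rule card_of_Plus_mono1)
      also have "|M <+> S \<times> S| \<le>o |M <+> M \<times> M|"
        using ordLeq_transitive[OF card_of_Times_mono1[OF S(2)] card_of_Times_mono2[OF S(2)]]
        by (rule card_of_Plus_mono2)
      also have "|M <+> M \<times> M| =o |M2|" by (rule M2(1))
      finally show ?thesis .
    qed
    moreover have "\<exists>t \<in> J. \<exists>s \<in> S'. y \<otimes> inv s \<in> L t m1" if y: "y \<in> V k" for y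
    proof -
      have yc: "y \<in> carrier G" using V_carrier y .
      have "\<exists>t \<in> J. \<exists>s \<in> S'. y \<otimes> inv s \<in> L t m"
      proof (cases "\<exists>t \<in> J. \<exists>s \<in> S. y \<otimes> inv s \<in> L t m")
        case True
        then show ?thesis unfolding S'_def by blast
      next
        case False
        then obtain s where s: "s \<in> S" "y \<otimes> inv s \<in> L a m" using cov y by blast
        \<comment> \<open>\<open>z\<close> lies in the coset of \<open>x\<close> modulo
          \<open>L a m\<close>, which avoids \<open>S\<close>, so it is covered through some
          \<open>t\<close> in \<open>J\<close>; translating that coset back covers \<open>y\<close>
          with a representative from \<open>S'\<close>.\<close>
        define z where "z = y \<otimes> inv s \<otimes> x"
        have "z \<in> V k"
          using s S(1) x(1) y subgroup.m_closed[OF V_subgroup] subgroup.m_inv_closed[OF V_subgroup]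
          by (auto simp: z_def subset_iff)
        then obtain t s' where t: "t \<in> insert a J" "s' \<in> S" "z \<otimes> inv s' \<in> L t m" using cov by blast
        note c = xc yc Sc[OF s(1)] Sc[OF t(2)]
        have "t \<noteq> a"
        proof
          assume "t = a"
          then have "inv (y \<otimes> inv s) \<otimes> (z \<otimes> inv s') \<in> L a m"
            using t(3) s(2) subgroup.m_closed[OF La] subgroup.m_inv_closed[OF La] by blast
          moreover have "inv (y \<otimes> inv s) \<otimes> (z \<otimes> inv s') = x \<otimes> inv s'"
          proof -
            have "inv (y \<otimes> inv s) \<otimes> (z \<otimes> inv s') = (inv (y \<otimes> inv s) \<otimes> (y \<otimes> inv s)) \<otimes> (x \<otimes> inv s')"
              unfolding z_def using c by (simp only: m_assoc inv_closed m_closed)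
            then show ?thesis using c by (simp add: l_inv)
          qed
          ultimately show False using x(2)[OF t(2)] by simp
        qed
        moreover have "z \<otimes> inv s' = y \<otimes> inv (s' \<otimes> inv x \<otimes> s)"
          using c by (simp add: z_def inv_mult_group m_assoc)
        moreover have "s' \<otimes> inv x \<otimes> s \<in> S'" using s t unfolding S'_def by force
        ultimately show ?thesis using t by auto
      qed
      then show ?thesis using L_antimono[of _ m1 m] J by (fastforce simp: m_def)
    qed
    ultimately show False using m1 by blast
  qed
  then show ?case by blast
qed

text \<open>Take a maximal subset of \<open>V k\<close> independent for all the congruences. If it
  were too small, its cosets would cover \<open>V k\<close>, against
  \<open>not_covered\<close>.\<close>

lemma large_independent:
  assumes X: "|X| <o lam"
  obtains m e where "m > k" "e ` X \<subseteq> V k"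
    "\<And>x y t. \<lbrakk>x \<in> X; y \<in> X; x \<noteq> y; t \<in> I\<rbrakk> \<Longrightarrow> e x \<otimes> inv (e y) \<notin> L t m"
proof -
  obtain M :: "'k set" where M: "|X| =o |M|" "|M| <o lam" using small_copy[OF X] .
  obtain m0 where m0: "\<And>S. S \<subseteq> V k \<Longrightarrow> |S| \<le>o |M| \<Longrightarrow>
      \<not> (\<forall>x \<in> V k. \<exists>t \<in> I. \<exists>s \<in> S. x \<otimes> inv s \<in> L t m0)"
    using not_covered[OF order_refl M(2)] by blast
  \<comment> \<open>The term \<open>Suc k\<close> forces \<open>m > k\<close>, so that the levels of
    the tree strictly increase.\<close>
  define m where "m = max m0 (Suc k)"
  define R where "R x y \<longleftrightarrow> x \<in> carrier G \<and> y \<in> carrier G \<and> (\<exists>t \<in> I. x \<otimes> inv y \<in> L t m)" for x y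
  have "R y x" if "R x y" for x y
    using that rcong_sym[OF separatingD(5)[OF sep]] unfolding R_def by blast
  then obtain S where S: "S \<subseteq> V k" "\<And>x y. x \<in> S \<Longrightarrow> y \<in> S \<Longrightarrow> x \<noteq> y \<Longrightarrow> \<not> R x y"
    "\<And>x. x \<in> V k \<Longrightarrow> x \<in> S \<or> (\<exists>y \<in> S. R x y)"
    using maximal_independent[of R "V k"] by metis
  have "\<not> |S| \<le>o |M|"
  proof
    assume "|S| \<le>o |M|"
    then have "\<not> (\<forall>x \<in> V k. \<exists>t \<in> I. \<exists>s \<in> S. x \<otimes> inv s \<in> L t m0)" using m0[OF S(1)] by blast
    moreover have "\<exists>t \<in> I. \<exists>s \<in> S. x \<otimes> inv s \<in> L t m0" if x: "x \<in> V k" for x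
    proof -
      obtain t0 where t0: "t0 \<in> I" using ne by blast
      have "x \<otimes> inv x \<in> L t0 m0"
        using V_carrier[OF x] subgroup.one_closed[OF separatingD(5)[OF sep[OF t0]]] by simp
      then show ?thesis
        using S(3)[OF x] t0 L_antimono[of _ m0 m] unfolding R_def m_def by fastforce
    qed
    ultimately show False by blast
  qed
  then have "|M| \<le>o |S|" using ordLeq_total[OF card_of_Well_order card_of_Well_order] by blast
  then have "|X| \<le>o |S|" using M(1) ordIso_ordLeq_trans by blast
  then obtain e where e: "inj_on e X" "e ` X \<subseteq> S" using card_of_ordLeq by metis
  show thesis
  proof (rule that)
    show "m > k" by (simp add: m_def)
    show "e ` X \<subseteq> V k" using e S(1) by blast
    show "e x \<otimes> inv (e y) \<notin> L t m" if "x \<in> X" "y \<in> X" "x \<noteq> y" "t \<in> I" for x y t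
    proof -
      have "e x \<in> S" "e y \<in> S" "e x \<noteq> e y" using e that by (auto simp: inj_on_def)
      then show ?thesis using S(1,2) V_carrier that(4) unfolding R_def by blast
    qed
  qed
qed

text \<open>A branch is a subset \<open>X\<close> of \<open>Field lam\<close>, seen at level
  \<open>n\<close> as \<open>X \<inter> A n\<close>, and each level contributes one factor. At the
  first level where two branches differ the factors are incongruent, and later factors lie too deep
  in \<open>V\<close> to undo this.\<close>

lemma large_family:
  obtains f :: "'k set \<Rightarrow> 'a" where "f ` Pow (Field lam) \<subseteq> carrier G"
    "\<forall>X \<in> Pow (Field lam). \<forall>Y \<in> Pow (Field lam). X \<noteq> Y \<longrightarrow> (\<forall>t \<in> I. f X \<otimes> inv (f Y) \<notin> Z t)"
proof -
  obtain A :: "nat \<Rightarrow> 'k set" where A: "\<And>n. |A n| <o lam" "(\<Union>n. A n) = Field lam"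
    using exhaustion by metis
  define Q where "Q n k m e \<longleftrightarrow> m > k \<and> e ` Pow (A n) \<subseteq> V k \<and>
      (\<forall>X \<in> Pow (A n). \<forall>Y \<in> Pow (A n). X \<noteq> Y \<longrightarrow> (\<forall>t \<in> I. e X \<otimes> inv (e Y) \<notin> L t m))"
    for n k m and e :: "'k set \<Rightarrow> 'a"
  have "\<exists>m e. Q n k m e" for n k
  proof -
    obtain m e where "m > k" "e ` Pow (A n) \<subseteq> V k"
      "\<And>X Y t. \<lbrakk>X \<in> Pow (A n); Y \<in> Pow (A n); X \<noteq> Y; t \<in> I\<rbrakk> \<Longrightarrow> e X \<otimes> inv (e Y) \<notin> L t m"
      using large_independent[OF small_Pow[OF A(1)], where k = k] by metis
    then have "Q n k m e" unfolding Q_def by blast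
    then show ?thesis by blast
  qed
  then obtain \<mu> e where Q: "\<And>n k. Q n k (\<mu> n k) (e n k)" by metis
  have \<mu>e: "\<And>n k. \<mu> n k > k" "\<And>n k. e n k ` Pow (A n) \<subseteq> V k"
    "\<And>n k X Y t. \<lbrakk>X \<in> Pow (A n); Y \<in> Pow (A n); X \<noteq> Y; t \<in> I\<rbrakk> \<Longrightarrow>
       e n k X \<otimes> inv (e n k Y) \<notin> L t (\<mu> n k)"
    using Q unfolding Q_def by blast+
  define d where "d = rec_nat 0 \<mu>"
  have d_Suc: "d (Suc n) = \<mu> n (d n)" for n by (simp add: d_def)
  have d_mono: "strict_mono d" using \<mu>e(1) by (simp add: strict_mono_Suc_iff d_Suc)
  define E where "E n X = e n (d n) (X \<inter> A n)" for n X
  have E_V: "E n X \<in> V (d n)" for n X using \<mu>e(2)[of n "d n"] unfolding E_def by blast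
  note Ec = V_carrier[OF E_V]
  \<comment> \<open>New factors go on the left, so the quotient of successive terms is
    \<open>E i X\<close> itself rather than a conjugate, which might leave
    \<open>V (d n)\<close>.\<close>
  define y where "y X = rec_nat \<one> (\<lambda>n g. E n X \<otimes> g)" for X
  have y_0: "y X 0 = \<one>" and y_Suc: "y X (Suc n) = E n X \<otimes> y X n" for X n by (simp_all add: y_def)
  have yc: "y X n \<in> carrier G" for X n by (induction n) (simp_all add: y_0 y_Suc Ec)
  have tail: "y X i \<otimes> inv (y X n) \<in> V (d n)" if "n \<le> i" for X n i
    using that
  proof (induction i rule: dec_induct)
    case base
    then show ?case using subgroup.one_closed[OF V_subgroup] yc by simp
  next
    case (step i)
    have "d n \<le> d i" using d_mono step(1) by (simp add: strict_mono_less_eq)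
    then have "E i X \<in> V (d n)" using E_V V_antimono by blast
    moreover have "y X (Suc i) \<otimes> inv (y X i) = E i X"
      using Ec yc by (simp add: y_Suc m_assoc)
    ultimately show ?case using rcong_trans[OF V_subgroup yc yc yc _ step.IH] by simp
  qed
  have "\<exists>g \<in> carrier G. tends V (y X) g" for X
  proof -
    have "cauchy V (y X)"
      unfolding cauchy_def
    proof (intro allI exI impI)
      fix n i j :: nat assume i: "n \<le> i" and j: "n \<le> j"
      have "y X i \<otimes> inv (y X j) \<in> V (d n)"
        using rcong_trans[OF V_subgroup yc yc yc tail[OF i] rcong_sym[OF V_subgroup yc yc tail[OF j]]] .
      then show "y X i \<otimes> inv (y X j) \<in> V n"
        using V_antimono[OF strict_mono_imp_increasing[OF d_mono]] by blast
    qed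
    then show ?thesis using V_complete[of "y X"] yc by blast
  qed
  then obtain f where f: "\<And>X. f X \<in> carrier G" "\<And>X. tends V (y X) (f X)" by metis
  have fy: "f X \<otimes> inv (y X n) \<in> V (d n)" for X n
  proof -
    obtain N where "\<forall>j\<ge>N. f X \<otimes> inv (y X j) \<in> V (d n)" using f(2) unfolding tends_def by blast
    then have "f X \<otimes> inv (y X (max N n)) \<in> V (d n)" by simp
    then show ?thesis using rcong_trans[OF V_subgroup f(1) yc yc _ tail[of n "max N n"]] by simp
  qed
  show thesis
  proof (rule that)
    show "f ` Pow (Field lam) \<subseteq> carrier G" using f(1) by blast
    show "\<forall>X \<in> Pow (Field lam). \<forall>Y \<in> Pow (Field lam). X \<noteq> Y \<longrightarrow> (\<forall>t \<in> I. f X \<otimes> inv (f Y) \<notin> Z t)"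
    proof (intro ballI impI)
      fix X Y t assume "X \<in> Pow (Field lam)" "Y \<in> Pow (Field lam)" "X \<noteq> Y" and t: "t \<in> I"
      then have XY: "X \<subseteq> Field lam" "Y \<subseteq> Field lam" "X \<noteq> Y" by auto
      have "\<exists>n. X \<inter> A n \<noteq> Y \<inter> A n"
      proof (rule ccontr)
        assume "\<not> ?thesis"
        then have "X \<inter> (\<Union>n. A n) = Y \<inter> (\<Union>n. A n)" unfolding Int_UN_distrib by simp
        then show False using XY unfolding A(2) by (simp add: Int_absorb2)
    qed
    then obtain n where n: "X \<inter> A n \<noteq> Y \<inter> A n" "\<And>i. i < n \<Longrightarrow> X \<inter> A i = Y \<inter> A i"
      using exists_least_iff[of "\<lambda>n. X \<inter> A n \<noteq> Y \<inter> A n"] by blast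
    have eq: "y X i = y Y i" if "i \<le> n" for i
      using that by (induction i) (simp_all add: y_0 y_Suc E_def n(2))
    define l where "l = d (Suc n)"
    have Ls: "subgroup (L t l) G" using separatingD(5)[OF sep[OF t]] .
    have EE: "E n X \<otimes> inv (E n Y) \<notin> L t l"
      using \<mu>e(3)[of "X \<inter> A n" n "Y \<inter> A n" t "d n"] n(1) t by (simp add: E_def l_def d_Suc)
    \<comment> \<open>The factors below level \<open>n\<close> agree, so they cancel in the
      quotient.\<close>
    have yy: "y X (Suc n) \<otimes> inv (y Y (Suc n)) = E n X \<otimes> inv (E n Y)"
    proof -
      have "y X (Suc n) \<otimes> inv (y Y (Suc n)) = E n X \<otimes> ((y Y n \<otimes> inv (y Y n)) \<otimes> inv (E n Y))"
        using Ec yc eq[of n] by (simp only: y_Suc inv_mult_group m_assoc inv_closed m_closed order_refl)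
      then show ?thesis using Ec yc by simp
    qed
    \<comment> \<open>Both limits differ from their partial products by elements of
      \<open>V l\<close>, which lies in \<open>L t l\<close>; a congruence of the limits would pass
      to the partial products.\<close>
    have "f X \<otimes> inv (f Y) \<notin> L t l"
    proof
      assume XY: "f X \<otimes> inv (f Y) \<in> L t l"
      have 1: "f X \<otimes> inv (y X (Suc n)) \<in> L t l" "f Y \<otimes> inv (y Y (Suc n)) \<in> L t l"
        using fy V_subset_L[OF t] unfolding l_def by blast+
      have "y X (Suc n) \<otimes> inv (f Y) \<in> L t l"
        using rcong_trans[OF Ls yc f(1) f(1) rcong_sym[OF Ls f(1) yc 1(1)] XY] .
      then have "y X (Suc n) \<otimes> inv (y Y (Suc n)) \<in> L t l"
        using rcong_trans[OF Ls yc f(1) yc _ 1(2)] by blast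
      then show False using EE yy by simp
    qed
    then show "f X \<otimes> inv (f Y) \<notin> Z t" using separatingD(8)[OF sep[OF t]] by blast
    qed
  qed
qed

end

end

section \<open>From incongruence modulo \<open>K n\<close> to incongruence modulo the whole
  image\<close>

lemma (in strong_limit_omega) small_Sigma_finite:
  assumes "finite I" "\<And>t. t \<in> I \<Longrightarrow> |B t| <o lam"
  shows "|SIGMA t:I. B t| <o lam"
  using assms
proof (induction I rule: finite_induct)
  case empty
  then show ?case using small_finite[of "{}"] by simp
next
  case (insert t I)
  have "(SIGMA s:insert t I. B s) = ({t} \<times> B t) \<union> (SIGMA s:I. B s)" by auto
  moreover have "|{t} \<times> B t| <o lam" using small_Times[OF small_finite] insert.prems by blast
  ultimately show ?case using small_Un insert by simp
qed

text \<open>Were \<open>S\<close> small, the product would be smaller than \<open>lam\<close>. So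
  \<open>S\<close> is infinite and at least as large as \<open>Q\<close>, and the product is no
  larger than \<open>S\<close>.\<close>

lemma (in strong_limit_omega) Pow_ordLeq_of_small_fibres:
  assumes "|Pow (Field lam)| \<le>o |S \<times> Q|" "|Q| <o lam"
  shows "|Pow (Field lam)| \<le>o |S|"
proof -
  have lam_Pow: "lam <o |Pow (Field lam)|" using Card_order_Pow[OF card_lam] .
  have "\<not> |S| <o lam"
  proof
    assume "|S| <o lam"
    then have "|S \<times> Q| <o lam" using small_Times assms(2) by blast
    then have "|Pow (Field lam)| <o lam" using assms(1) small_mono by blast
    then show False using lam_Pow ordLess_transitive ordLess_irreflexive by blast
  qed
  then have lam_S: "lam \<le>o |S|"
    using card_lam ordLess_or_ordLeq[OF card_of_Well_order, of lam S] by (auto simp: card_order_on_def)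
  then have Q_S: "|Q| \<le>o |S|" using assms(2) ordLess_ordLeq_trans ordLess_imp_ordLeq by blast
  have "infinite S" using \<open>\<not> |S| <o lam\<close> small_finite by blast
  then have "|S \<times> Q| \<le>o |S|"
    using card_of_Times_ordLeq_infinite_Field[OF _ ordLeq_refl[OF card_of_Card_order, of S] Q_S
        card_of_Card_order]
    by (simp add: Field_card_of)
  then show ?thesis using assms(1) ordLeq_transitive by blast
qed

context filtered_lam_group
begin

text \<open>\<open>\<phi> t n\<close> takes few values and separates the cosets of
  \<open>N t n\<close>. It bounds the degree of the graph of congruence modulo some image, on a
  family already incongruent modulo the images of the \<open>N t (n t)\<close>.\<close>

lemma ex_independent_family:
  fixes H :: "'i \<Rightarrow> ('b, 'n) monoid_scheme" and N :: "'i \<Rightarrow> nat \<Rightarrow> 'b set" and \<sigma> :: "'i \<Rightarrow> 'b \<Rightarrow> 'a"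
    and \<phi> :: "'i \<Rightarrow> nat \<Rightarrow> 'b \<Rightarrow> 'c"
  assumes fin: "finite I" and ne: "I \<noteq> {}"
    and hom: "\<And>t. t \<in> I \<Longrightarrow> filtered_lam_hom G U lam (H t) (N t) (\<sigma> t)"
    and small: "\<And>t n. t \<in> I \<Longrightarrow> |\<phi> t n ` carrier (H t)| <o lam"
    and \<phi>: "\<And>t n a b. \<lbrakk>t \<in> I; a \<in> carrier (H t); b \<in> carrier (H t); \<phi> t n a = \<phi> t n b\<rbrakk> \<Longrightarrow>
       a \<otimes>\<^bsub>H t\<^esub> inv\<^bsub>H t\<^esub> b \<in> N t n"
  obtains f :: "'k set \<Rightarrow> 'a" and S where "|Pow (Field lam)| \<le>o |S|" "f ` S \<subseteq> carrier G"
    "\<forall>X \<in> S. \<forall>Y \<in> S. X \<noteq> Y \<longrightarrow> (\<forall>t \<in> I. f X \<otimes> inv (f Y) \<notin> \<sigma> t ` carrier (H t))"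
proof -
  have "\<forall>t. \<exists>W L n. t \<in> I \<longrightarrow> separating W L (\<sigma> t ` N t n)"
    using filtered_lam_hom.ex_separating[OF hom] by blast
  then obtain W L n where sep: "\<And>t. t \<in> I \<Longrightarrow> separating (W t) (L t) (\<sigma> t ` N t (n t))"
    by metis
  obtain f :: "'k set \<Rightarrow> 'a" where f0: "f ` Pow (Field lam) \<subseteq> carrier G"
    "\<forall>X \<in> Pow (Field lam). \<forall>Y \<in> Pow (Field lam). X \<noteq> Y \<longrightarrow>
       (\<forall>t \<in> I. f X \<otimes> inv (f Y) \<notin> \<sigma> t ` N t (n t))"
    using large_family[where I = I and W = W and L = L and Z = "\<lambda>t. \<sigma> t ` N t (n t)", OF fin ne sep] .
  have f: "f X \<in> carrier G" if "X \<in> Pow (Field lam)" for X using f0(1) that by blast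
  have gh: "group_hom (H t) G (\<sigma> t)" if "t \<in> I" for t
    using filtered_lam_hom.group_hom[OF hom[OF that]] .
  have im: "subgroup (\<sigma> t ` carrier (H t)) G" if "t \<in> I" for t
    using group_hom.img_is_subgroup[OF gh[OF that]] .
  let ?P = "Pow (Field lam)"
  define R where "R X Y \<longleftrightarrow> X \<in> ?P \<and> Y \<in> ?P \<and> (\<exists>t \<in> I. f X \<otimes> inv (f Y) \<in> \<sigma> t ` carrier (H t))" for X Y
  have "R Y X" if R: "R X Y" for X Y
  proof -
    obtain t where t: "t \<in> I" "f X \<otimes> inv (f Y) \<in> \<sigma> t ` carrier (H t)"
      using R unfolding R_def by blast
    have XY: "X \<in> ?P" "Y \<in> ?P" using R unfolding R_def by blast+
    have "f Y \<otimes> inv (f X) \<in> \<sigma> t ` carrier (H t)"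
      using rcong_sym[OF im[OF t(1)] f[OF XY(1)] f[OF XY(2)] t(2)] .
    then show ?thesis using XY t(1) unfolding R_def by blast
  qed
  then obtain S where S: "S \<subseteq> ?P" "\<And>X Y. X \<in> S \<Longrightarrow> Y \<in> S \<Longrightarrow> X \<noteq> Y \<Longrightarrow> \<not> R X Y"
    "\<And>X. X \<in> ?P \<Longrightarrow> X \<in> S \<or> (\<exists>Y \<in> S. R X Y)"
    using maximal_independent[of R ?P] by metis
  define Q where "Q = (SIGMA t:I. \<phi> t (n t) ` carrier (H t))"
  have Q: "|Q| <o lam" unfolding Q_def using small by (intro small_Sigma_finite fin)
  have degree: "|{X. R X Y}| \<le>o |Q|" if Y: "Y \<in> ?P" for Y
  proof -
    have "\<forall>X. \<exists>t a. R X Y \<longrightarrow> t \<in> I \<and> a \<in> carrier (H t) \<and> f X \<otimes> inv (f Y) = \<sigma> t a"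
      unfolding R_def by blast
    then obtain t a where ta: "\<And>X. R X Y \<Longrightarrow> t X \<in> I \<and> a X \<in> carrier (H (t X)) \<and>
        f X \<otimes> inv (f Y) = \<sigma> (t X) (a X)"
      by metis
    \<comment> \<open>\<open>q X\<close> records which \<open>t\<close> links \<open>X\<close> to
      \<open>Y\<close>, and the value of \<open>\<phi>\<close> at the linking element. Two sets with
      the same record would be congruent modulo the image of some \<open>N t (n t)\<close>, hence
      are equal.\<close>
    define q where "q X = (t X, \<phi> (t X) (n (t X)) (a X))" for X
    have "inj_on q {X. R X Y}"
    proof (rule inj_onI, rule ccontr)
      fix X X' assume "X \<in> {X. R X Y}" "X' \<in> {X. R X Y}" and q: "q X = q X'" and neq: "X \<noteq> X'"
      then have R: "R X Y" "R X' Y" by auto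
      define s where "s = t X"
      have s: "s \<in> I" "a X \<in> carrier (H s)" "a X' \<in> carrier (H s)"
        "f X \<otimes> inv (f Y) = \<sigma> s (a X)" "f X' \<otimes> inv (f Y) = \<sigma> s (a X')"
        "\<phi> s (n s) (a X) = \<phi> s (n s) (a X')"
        using ta[OF R(1)] ta[OF R(2)] q unfolding s_def q_def by auto
      interpret h: group_hom "H s" G "\<sigma> s" using gh[OF s(1)] .
      have c: "f X \<in> carrier G" "f X' \<in> carrier G" "f Y \<in> carrier G"
        using f R by (auto simp: R_def)
      have "a X \<otimes>\<^bsub>H s\<^esub> inv\<^bsub>H s\<^esub> a X' \<in> N s (n s)" using \<phi> s by blast
      moreover have "\<sigma> s (a X \<otimes>\<^bsub>H s\<^esub> inv\<^bsub>H s\<^esub> a X') = f X \<otimes> inv (f X')"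
      proof -
        have "\<sigma> s (a X \<otimes>\<^bsub>H s\<^esub> inv\<^bsub>H s\<^esub> a X') = (f X \<otimes> inv (f Y)) \<otimes> inv (f X' \<otimes> inv (f Y))"
          using s by simp
        also have "\<dots> = f X \<otimes> inv (f X')"
          using c inv_mult_inv[OF c(2,3)] mult_inv_cancel_mid[OF c(1,3,2)] by simp
        finally show ?thesis .
      qed
      ultimately have "f X \<otimes> inv (f X') \<in> \<sigma> s ` N s (n s)" by (metis imageI)
      then show False using f0(2) R neq s(1) unfolding R_def by blast
    qed
    moreover have "q ` {X. R X Y} \<subseteq> Q" using ta unfolding q_def Q_def by auto
    ultimately show ?thesis using card_of_ordLeq by blast
  qed
  have "?P \<subseteq> (\<Union>Y\<in>S. {X. R X Y})"
  proof
    fix X assume X: "X \<in> ?P"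
    obtain t where t: "t \<in> I" using ne by blast
    \<comment> \<open>\<open>R\<close> is reflexive on \<open>?P\<close> since \<open>I\<close> is
      nonempty, so the neighbourhoods of members of \<open>S\<close> cover \<open>S\<close> as
      well.\<close>
    have "R X X"
      using X t f[OF X] subgroup.one_closed[OF im[OF t]] unfolding R_def by auto
    then show "X \<in> (\<Union>Y\<in>S. {X. R X Y})" using S(3)[OF X] by blast
  qed
  then have "|?P| \<le>o |\<Union>Y\<in>S. {X. R X Y}|" by (rule card_of_mono1)
  also have "|\<Union>Y\<in>S. {X. R X Y}| \<le>o |SIGMA Y:S. {X. R X Y}|" by (rule card_of_UNION_Sigma)
  also have "|SIGMA Y:S. {X. R X Y}| \<le>o |S \<times> Q|"
    using degree S(1) by (intro card_of_Sigma_mono1) blast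
  finally have "|?P| \<le>o |S \<times> Q|" .
  then have PS: "|?P| \<le>o |S|" using Q by (rule Pow_ordLeq_of_small_fibres)
  show thesis
  proof (rule that[OF PS])
    show "f ` S \<subseteq> carrier G" using f S(1) by blast
    show "\<forall>X \<in> S. \<forall>Y \<in> S. X \<noteq> Y \<longrightarrow> (\<forall>t \<in> I. f X \<otimes> inv (f Y) \<notin> \<sigma> t ` carrier (H t))"
      using S(1,2) unfolding R_def by blast
  qed
qed

end

section \<open>Inverse limits\<close>

definition limit_kernel :: "(nat \<Rightarrow> 'a monoid) \<Rightarrow> (nat \<Rightarrow> nat \<Rightarrow> 'a \<Rightarrow> 'a) \<Rightarrow> nat \<Rightarrow> (nat \<Rightarrow> 'a) set" where
  "limit_kernel G \<pi> n = kernel (inverse_limit G \<pi>) (G n) (limit_proj n)"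

lemma group_hom_limit_proj:
  assumes "inverse_system G \<pi>"
  shows "group_hom (inverse_limit G \<pi>) (G n) (limit_proj n)"
  using assms group_inverse_limit[OF assms] limit_proj_hom
  by (auto simp: group_hom_def group_hom_axioms_def inverse_system_def)

lemma diff_mem_limit_kernel_iff:
  assumes "inverse_system G \<pi>"
    and "x \<in> carrier (inverse_limit G \<pi>)" "y \<in> carrier (inverse_limit G \<pi>)"
  shows "x \<otimes>\<^bsub>inverse_limit G \<pi>\<^esub> inv\<^bsub>inverse_limit G \<pi>\<^esub> y \<in> limit_kernel G \<pi> n \<longleftrightarrow> x n = y n"
proof -
  interpret group_hom "inverse_limit G \<pi>" "G n" "limit_proj n"
    using group_hom_limit_proj[OF assms(1)] .
  have c: "limit_proj n x \<in> carrier (G n)" "limit_proj n y \<in> carrier (G n)" using assms by auto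
  have "x \<otimes>\<^bsub>inverse_limit G \<pi>\<^esub> inv\<^bsub>inverse_limit G \<pi>\<^esub> y \<in> limit_kernel G \<pi> n \<longleftrightarrow>
      limit_proj n x \<otimes>\<^bsub>G n\<^esub> inv\<^bsub>G n\<^esub> (limit_proj n y) = \<one>\<^bsub>G n\<^esub>"
    using assms by (simp add: limit_kernel_def kernel_def)
  also have "\<dots> \<longleftrightarrow> limit_proj n x = limit_proj n y"
    using c by (metis H.inv_equality H.inv_inv H.inv_closed H.r_inv)
  finally show ?thesis by (simp add: limit_proj_def)
qed

lemma filtered_group_inverse_limit:
  assumes sys: "inverse_system G \<pi>"
  shows "filtered_group (inverse_limit G \<pi>) (limit_kernel G \<pi>)"
proof -
  let ?G = "inverse_limit G \<pi>" and ?U = "limit_kernel G \<pi>"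
  interpret group ?G using group_inverse_limit[OF sys] .
  note diff = diff_mem_limit_kernel_iff[OF sys]
  show ?thesis
  proof (intro filtered_group.intro filtered_group_axioms.intro)
    show "group ?G" by (rule is_group)
    show "?U n \<lhd> ?G" for n
      unfolding limit_kernel_def using group_hom.normal_kernel[OF group_hom_limit_proj[OF sys]] .
    show "?U (Suc n) \<subseteq> ?U n" for n
    proof
      fix x assume x: "x \<in> ?U (Suc n)"
      have "\<pi> n (Suc n) \<in> hom (G (Suc n)) (G n)" "group (G n)" "group (G (Suc n))"
        using sys by (auto simp: inverse_system_def)
      then have "\<pi> n (Suc n) \<one>\<^bsub>G (Suc n)\<^esub> = \<one>\<^bsub>G n\<^esub>" using hom_one by blast
      moreover have "\<pi> n (Suc n) (x (Suc n)) = x n"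
        using x by (auto simp: limit_kernel_def kernel_def carrier_inverse_limit)
      ultimately show "x \<in> ?U n" using x by (auto simp: limit_kernel_def kernel_def limit_proj_def)
    qed
    show "(\<Inter>n. ?U n) = {\<one>\<^bsub>?G\<^esub>}"
    proof (intro equalityI subsetI)
      fix x assume "x \<in> (\<Inter>n. ?U n)"
      then have x: "x \<in> ?U n" for n by blast
      then have xc: "x \<in> carrier ?G" by (auto simp: limit_kernel_def kernel_def)
      have "x n = \<one>\<^bsub>?G\<^esub> n" for n using diff[OF xc one_closed, of n] x[of n] xc by simp
      then show "x \<in> {\<one>\<^bsub>?G\<^esub>}" by (simp add: fun_eq_iff)
    next
      fix x assume "x \<in> {\<one>\<^bsub>?G\<^esub>}"
      then show "x \<in> (\<Inter>n. ?U n)" using diff[OF one_closed one_closed] by simp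
    qed
    fix y assume y: "range y \<subseteq> carrier ?G" and c: "cauchy ?U y"
    have yc: "y i \<in> carrier ?G" for i using y by blast
    have "\<exists>N. \<forall>i\<ge>N. \<forall>j\<ge>N. y i n = y j n" for n
      using c unfolding cauchy_def diff[OF yc yc] by blast
    then obtain N where N: "\<And>n i j. i \<ge> N n \<Longrightarrow> j \<ge> N n \<Longrightarrow> y i n = y j n" by metis
    \<comment> \<open>Coordinate \<open>n\<close> of the Cauchy sequence is constant from
      \<open>N n\<close> on, and \<open>g\<close> collects the final values. Any two of them occur
      together in one late term, which gives compatibility.\<close>
    define g where "g n = y (N n) n" for n
    have g: "g n = y i n" if "i \<ge> N n" for n i unfolding g_def using N that by blast
    have "g n \<in> carrier (G n)" for n using yc by (auto simp: g_def carrier_inverse_limit)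
    moreover have "\<pi> m n (g n) = g m" if "m \<le> n" for m n
      using yc[of "max (N m) (N n)"] that g[of m "max (N m) (N n)"] g[of n "max (N m) (N n)"]
      by (simp add: carrier_inverse_limit)
    ultimately have gc: "g \<in> carrier ?G" by (simp add: carrier_inverse_limit)
    have "tends ?U y g"
      unfolding tends_def diff[OF gc yc] using g by blast
    then show "\<exists>g \<in> carrier ?G. tends ?U y g" using gc by blast
  qed
qed

theorem theorem1p1:
  fixes lam :: "'k rel"
    and G :: "nat \<Rightarrow> 'a monoid" and \<pi> :: "nat \<Rightarrow> nat \<Rightarrow> 'a \<Rightarrow> 'a"
    and I :: "'i set"
    and H :: "'i \<Rightarrow> nat \<Rightarrow> 'b monoid" and \<rho> :: "'i \<Rightarrow> nat \<Rightarrow> nat \<Rightarrow> 'b \<Rightarrow> 'b"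
    and \<sigma> :: "'i \<Rightarrow> nat \<Rightarrow> 'b \<Rightarrow> 'a"
  assumes "Card_order lam"
    and "lam =o natLeq \<or> (strong_limit_card lam \<and> has_cofinality lam natLeq)"
    and "inverse_system G \<pi>"
    and "\<And>n. |carrier (G n)| <o lam"
    and "finite I"
    and "\<And>t. t \<in> I \<Longrightarrow> inverse_system (H t) (\<rho> t)"
    and "\<And>t n. t \<in> I \<Longrightarrow> |carrier (H t n)| <o lam"
    and "\<And>t. t \<in> I \<Longrightarrow> inverse_system_hom (H t) (\<rho> t) G \<pi> (\<sigma> t)"
    and "\<And>\<mu> :: 'k rel. \<lbrakk>Card_order \<mu>; \<mu> <o lam\<rbrakk> \<Longrightarrow>
           \<exists>f \<in> Field \<mu> \<rightarrow> carrier (inverse_limit G \<pi>).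
             \<forall>i \<in> Field \<mu>. \<forall>j \<in> Field \<mu>. i \<noteq> j \<longrightarrow>
               (\<forall>t \<in> I. f i \<otimes>\<^bsub>inverse_limit G \<pi>\<^esub> inv\<^bsub>inverse_limit G \<pi>\<^esub> (f j)
                  \<notin> limit_map (\<sigma> t) ` carrier (inverse_limit (H t) (\<rho> t)))"
  shows "\<exists>f \<in> Field (ctwo ^c lam) \<rightarrow> carrier (inverse_limit G \<pi>).
           \<forall>i \<in> Field (ctwo ^c lam). \<forall>j \<in> Field (ctwo ^c lam). i \<noteq> j \<longrightarrow>
             (\<forall>t \<in> I. f i \<otimes>\<^bsub>inverse_limit G \<pi>\<^esub> inv\<^bsub>inverse_limit G \<pi>\<^esub> (f j)
                \<notin> limit_map (\<sigma> t) ` carrier (inverse_limit (H t) (\<rho> t)))"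
proof -
  let ?G = "inverse_limit G \<pi>"
  let ?H = "\<lambda>t. inverse_limit (H t) (\<rho> t)"
  interpret strong_limit_omega lam using strong_limit_omegaI[OF assms(1,2)] .
  interpret fG: filtered_group ?G "limit_kernel G \<pi>"
    using filtered_group_inverse_limit[OF assms(3)] .
  interpret lG: lam_group ?G lam by intro_locales
  interpret flG: filtered_lam_group ?G "limit_kernel G \<pi>" lam
  proof
    fix n
    show "lG.small_index (limit_kernel G \<pi> n)"
    proof (rule lG.small_indexI[where f = "\<lambda>x. x n"])
      have "(\<lambda>x. x n) ` carrier ?G \<subseteq> carrier (G n)" by (auto simp: carrier_inverse_limit)
      then show "|(\<lambda>x. x n) ` carrier ?G| <o lam" using small_mono[OF card_of_mono1 assms(4)] by blast
    qed (simp add: diff_mem_limit_kernel_iff[OF assms(3)])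
  qed
  show ?thesis
  proof (cases "I = {}")
    case True
    \<comment> \<open>With no conditions to meet, a constant family will do.\<close>
    then show ?thesis using fG.one_closed by (intro bexI[of _ "\<lambda>_. \<one>\<^bsub>?G\<^esub>"]) auto
  next
    case False
    have hom: "filtered_lam_hom ?G (limit_kernel G \<pi>) lam (?H t)
        (limit_kernel (H t) (\<rho> t)) (limit_map (\<sigma> t))"
      if t: "t \<in> I" for t
    proof -
      let ?R = "limit_map (\<sigma> t) ` carrier (?H t)"
      have h: "limit_map (\<sigma> t) \<in> hom (?H t) ?G" using limit_map_hom[OF assms(8)[OF t]] .
      interpret fH: filtered_group "?H t" "limit_kernel (H t) (\<rho> t)"
        using filtered_group_inverse_limit[OF assms(6)[OF t]] .
      have gh: "group_hom (?H t) ?G (limit_map (\<sigma> t))"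
        using h fG.is_group fH.is_group by (simp add: group_hom_def group_hom_axioms_def)
      have R: "subgroup ?R ?G" using group_hom.img_is_subgroup[OF gh] .
      show ?thesis
      proof
        show "limit_map (\<sigma> t) \<in> hom (?H t) ?G" by (rule h)
        show "limit_map (\<sigma> t) ` limit_kernel (H t) (\<rho> t) n \<subseteq> limit_kernel G \<pi> n" for n
        proof
          fix x assume "x \<in> limit_map (\<sigma> t) ` limit_kernel (H t) (\<rho> t) n"
          then obtain z where z: "z \<in> carrier (?H t)" "z n = \<one>\<^bsub>H t n\<^esub>" "x = limit_map (\<sigma> t) z"
            by (auto simp: limit_kernel_def kernel_def limit_proj_def)
          have "\<sigma> t n \<in> hom (H t n) (G n)" "group (H t n)" "group (G n)"
            using assms(8)[OF t] assms(6)[OF t] assms(3)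
            by (auto simp: inverse_system_hom_def inverse_system_def)
          then have "\<sigma> t n \<one>\<^bsub>H t n\<^esub> = \<one>\<^bsub>G n\<^esub>" using hom_one by blast
          moreover have "x \<in> carrier ?G" using h z by (auto simp: hom_def)
          ultimately show "x \<in> limit_kernel G \<pi> n"
            using z by (simp add: limit_kernel_def kernel_def limit_proj_def limit_map_def)
        qed
        show "\<not> lG.small_index ?R"
        proof
          assume "lG.small_index ?R"
          then obtain S where S: "S \<subseteq> carrier ?G" "|S| <o lam"
            "\<forall>x \<in> carrier ?G. \<exists>s \<in> S. x \<otimes>\<^bsub>?G\<^esub> inv\<^bsub>?G\<^esub> s \<in> ?R"
            by (rule lG.small_indexE)
          \<comment> \<open>The hypothesis is applied to \<open>|Pow S|\<close> elements. Two of
            them sharing a representative in \<open>S\<close> would be congruent modulo the image,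
            so they would inject into \<open>S\<close>, against Cantor's theorem.\<close>
          obtain M :: "'k set" where M: "|Pow S| =o |M|" "|M| <o lam"
            using small_copy[OF small_Pow[OF S(2)]] .
          obtain f where f: "f \<in> M \<rightarrow> carrier ?G" "\<forall>i\<in>M. \<forall>j\<in>M. i \<noteq> j \<longrightarrow>
              (\<forall>t \<in> I. f i \<otimes>\<^bsub>?G\<^esub> inv\<^bsub>?G\<^esub> (f j) \<notin> limit_map (\<sigma> t) ` carrier (?H t))"
            using assms(9)[OF card_of_Card_order M(2)] unfolding Field_card_of by blast
          have "\<forall>i. \<exists>s. i \<in> M \<longrightarrow> s \<in> S \<and> f i \<otimes>\<^bsub>?G\<^esub> inv\<^bsub>?G\<^esub> s \<in> ?R" using S(3) f(1) by blast
          then obtain s where s: "\<And>i. i \<in> M \<Longrightarrow> s i \<in> S \<and> f i \<otimes>\<^bsub>?G\<^esub> inv\<^bsub>?G\<^esub> s i \<in> ?R" by metis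
          have "inj_on s M"
          proof (rule inj_onI, rule ccontr)
            fix i j assume ij: "i \<in> M" "j \<in> M" "s i = s j" "i \<noteq> j"
            have c: "f i \<in> carrier ?G" "f j \<in> carrier ?G" "s j \<in> carrier ?G"
              using ij f(1) s S(1) by auto
            have "s j \<otimes>\<^bsub>?G\<^esub> inv\<^bsub>?G\<^esub> f j \<in> ?R" using fG.rcong_sym[OF R c(2,3)] s[OF ij(2)] by blast
            then have "f i \<otimes>\<^bsub>?G\<^esub> inv\<^bsub>?G\<^esub> f j \<in> ?R"
              using fG.rcong_trans[OF R c(1,3,2)] s[OF ij(1)] ij(3) by simp
            then show False using f(2) ij t by blast
          qed
          then have "|M| \<le>o |S|" using s card_of_ordLeq by blast
          then have "|Pow S| \<le>o |S|" using M(1) ordIso_ordLeq_trans by blast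
          then show False using card_of_Pow not_ordLess_ordLeq by blast
        qed
      qed
    qed
    have small: "|(\<lambda>x. x n) ` carrier (?H t)| <o lam" if t: "t \<in> I" for t n
    proof -
      have "(\<lambda>x. x n) ` carrier (?H t) \<subseteq> carrier (H t n)" by (auto simp: carrier_inverse_limit)
      then show ?thesis using small_mono[OF card_of_mono1 assms(7)[OF t]] by blast
    qed
    have diff: "a \<otimes>\<^bsub>?H t\<^esub> inv\<^bsub>?H t\<^esub> b \<in> limit_kernel (H t) (\<rho> t) n"
      if "t \<in> I" "a \<in> carrier (?H t)" "b \<in> carrier (?H t)" "a n = b n" for t n a b
      using that diff_mem_limit_kernel_iff[OF assms(6)[OF that(1)]] by blast
    obtain f :: "'k set \<Rightarrow> nat \<Rightarrow> 'a" and S where f: "|Pow (Field lam)| \<le>o |S|" "f ` S \<subseteq> carrier ?G"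
      "\<forall>X \<in> S. \<forall>Y \<in> S. X \<noteq> Y \<longrightarrow>
         (\<forall>t \<in> I. f X \<otimes>\<^bsub>?G\<^esub> inv\<^bsub>?G\<^esub> (f Y) \<notin> limit_map (\<sigma> t) ` carrier (?H t))"
      using flG.ex_independent_family[where \<phi> = "\<lambda>t n x. x n" and I = I and H = ?H
          and N = "\<lambda>t. limit_kernel (H t) (\<rho> t)" and \<sigma> = "\<lambda>t. limit_map (\<sigma> t)",
          OF assms(5) False hom small diff] .
    \<comment> \<open>The index set of the conclusion is a set of functions, equinumerous with
      \<open>Pow (Field lam)\<close>; an injection into \<open>S\<close> transports the family to
      it.\<close>
    let ?F = "Field (ctwo ^c lam)"
    have "|Pow (Field lam)| =o ctwo ^c lam"
      unfolding ctwo_def cexp_def Field_card_of by (rule card_of_Pow_Func)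
    then have "|Pow (Field lam)| =o |?F|"
      using card_of_Field_ordIso[OF Card_order_cexp] ordIso_symmetric ordIso_transitive by blast
    then have "|?F| \<le>o |S|" using f(1) ordIso_symmetric ordIso_ordLeq_trans by blast
    then obtain e where e: "inj_on e ?F" "e ` ?F \<subseteq> S" using card_of_ordLeq by metis
    show ?thesis
    proof (intro bexI[of _ "f \<circ> e"] ballI impI)
      show "f \<circ> e \<in> ?F \<rightarrow> carrier ?G" using e(2) f(2) by (simp add: Pi_iff image_subset_iff)
      show "(f \<circ> e) i \<otimes>\<^bsub>?G\<^esub> inv\<^bsub>?G\<^esub> (f \<circ> e) j \<notin> limit_map (\<sigma> t) ` carrier (?H t)"
        if "i \<in> ?F" "j \<in> ?F" "i \<noteq> j" "t \<in> I" for i j t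
      proof -
        have "e i \<in> S" "e j \<in> S" "e i \<noteq> e j" using e that by (auto simp: inj_on_def)
        then show ?thesis using f(3) that(4) by auto
      qed
    qed
  qed
qed

end
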